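(* Let $\Theta$ be an inner function on the unit disc $\mathbb{D}$ whose zeros (listed with multiplicity) form a super-separated sequence. Assume that $\Theta$ satisfies the Sharp Invertibility Property (SIP). Then $\Theta$ is a thin Blaschke product.
   Context: $H^\infty$ is the algebra of bounded analytic functions on $\mathbb{D}$ with the sup norm $\|\cdot\|_\infty$; an inner function is an element of $H^\infty$ with radial limits of modulus $1$ a.e. on $\partial\mathbb{D}$. $\mathcal{Z}(\Theta)$ is the zero set of $\Theta$. $\rho(z,w)=\left|\frac{z-w}{1-\bar wz}\right|$. A sequence $\{a_k\}\subset\mathbb{D}$ is super-separated if for every $\delta>0$ there exists $N\in\mathbb{N}$ such that $\rho(a_j,a_k)\ge1-\delta$ for all $j>k\ge N$. A Blaschke product $B$ with zeros $\{a_k\}$ is thin if $\lim_{k\to\infty}(1-|a_k|^2)|B'(a_k)|=1$. Blaschke products are understood up to unimodular constants. SIP: for every $\varepsilon>0$ there exists $\delta>0$ such that for every $f\in H^\infty$, the conditions $\|[f]\|\le1$ and $\inf_{\mathcal{Z}(\Theta)}|f|\ge1-\delta$ imply that $[f]$ is invertible in $H^\infty/\Theta H^\infty$ and $\|[f]^{-1}\|\le1+\varepsilon$, where $\|[f]\|=\inf\{\|f+g\Theta\|_\infty:g\in H^\infty\}$. *)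

theory Defs
  imports
    "HOL-Complex_Analysis.Complex_Analysis"
    "HOL-Algebra.QuotRing"
begin

abbreviation unit_disc :: "complex set" where
  "unit_disc \<equiv> ball 0 1"

text \<open>
  A function on the disc is represented by its extension by zero to the whole plane, so that
  equality in the carrier is equality on the disc and the unit of the ring is the indicator
  function of the disc.
\<close>

definition Hinf :: "(complex \<Rightarrow> complex) ring" where
  "Hinf = \<lparr>carrier = {f. f holomorphic_on unit_disc \<and> bounded (f ` unit_disc)
                          \<and> (\<forall>z. z \<notin> unit_disc \<longrightarrow> f z = 0)},
           mult = (\<lambda>f g z. f z * g z),
           one = (\<lambda>z. if z \<in> unit_disc then 1 else 0),
           zero = (\<lambda>z. 0),
           add = (\<lambda>f g z. f z + g z)\<rparr>"

definition sup_norm :: "(complex \<Rightarrow> complex) \<Rightarrow> real" where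
  "sup_norm f = (SUP z\<in>unit_disc. cmod (f z))"

definition inner_function :: "(complex \<Rightarrow> complex) \<Rightarrow> bool" where
  "inner_function \<Theta> \<longleftrightarrow> \<Theta> \<in> carrier Hinf \<and>
     (AE t\<in>{0..2*pi} in lborel.
        \<exists>l. cmod l = 1 \<and> ((\<lambda>r. \<Theta> (complex_of_real r * cis t)) \<longlongrightarrow> l) (at_left 1))"

definition zero_set :: "(complex \<Rightarrow> complex) \<Rightarrow> complex set" where
  "zero_set f = {z \<in> unit_disc. f z = 0}"

definition pseudo_dist :: "complex \<Rightarrow> complex \<Rightarrow> real" where
  "pseudo_dist z w = cmod ((z - w) / (1 - cnj w * z))"

text \<open>
  A finite or infinite sequence is given by a function \<open>a\<close> and a length \<open>N\<close>; only the terms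
  \<open>a k\<close> with \<open>k < N\<close> belong to it.
\<close>

definition lists_zeros :: "(complex \<Rightarrow> complex) \<Rightarrow> enat \<Rightarrow> (nat \<Rightarrow> complex) \<Rightarrow> bool" where
  "lists_zeros f N a \<longleftrightarrow>
     (\<forall>k. enat k < N \<longrightarrow> a k \<in> zero_set f) \<and>
     (\<forall>z\<in>zero_set f. finite {k. enat k < N \<and> a k = z} \<and>
                      int (card {k. enat k < N \<and> a k = z}) = zorder f z)"

definition super_separated :: "enat \<Rightarrow> (nat \<Rightarrow> complex) \<Rightarrow> bool" where
  "super_separated N a \<longleftrightarrow>
     (\<forall>k. enat k < N \<longrightarrow> a k \<in> unit_disc) \<and>
     (\<forall>\<delta>>0. \<exists>M. \<forall>j k. enat j < N \<and> j > k \<and> k \<ge> M \<longrightarrow> pseudo_dist (a j) (a k) \<ge> 1 - \<delta>)"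

definition blaschke_factor :: "complex \<Rightarrow> complex \<Rightarrow> complex" where
  "blaschke_factor a z =
     (if a = 0 then z else (complex_of_real (cmod a) / a) * ((a - z) / (1 - cnj a * z)))"

text \<open>Blaschke products are understood up to a unimodular constant \<open>c\<close>.\<close>

definition blaschke_product_with_zeros ::
    "(complex \<Rightarrow> complex) \<Rightarrow> enat \<Rightarrow> (nat \<Rightarrow> complex) \<Rightarrow> bool" where
  "blaschke_product_with_zeros B N a \<longleftrightarrow>
     (\<forall>k. enat k < N \<longrightarrow> a k \<in> unit_disc) \<and>
     summable (\<lambda>k. if enat k < N then 1 - cmod (a k) else 0) \<and>
     (\<exists>c. cmod c = 1 \<and>
       (\<forall>z\<in>unit_disc. B z = c * (\<Prod>k. if enat k < N then blaschke_factor (a k) z else 1)))"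

text \<open>
  For \<open>N = \<infinity>\<close> the filter below is \<^term>\<open>sequentially\<close>. For finite \<open>N\<close> it is trivial, which
  is the convention that finite Blaschke products are thin.
\<close>

definition thin_blaschke_product :: "(complex \<Rightarrow> complex) \<Rightarrow> bool" where
  "thin_blaschke_product B \<longleftrightarrow>
     (\<exists>N a. blaschke_product_with_zeros B N a \<and>
       ((\<lambda>k. (1 - (cmod (a k))\<^sup>2) * cmod (deriv B (a k))) \<longlongrightarrow> 1)
         (inf sequentially (principal {k. enat k < N})))"

definition Hinf_quot :: "(complex \<Rightarrow> complex) \<Rightarrow> (complex \<Rightarrow> complex) set ring" where
  "Hinf_quot \<Theta> = Hinf Quot (PIdl\<^bsub>Hinf\<^esub> \<Theta>)"

definition Hinf_class :: "(complex \<Rightarrow> complex) \<Rightarrow> (complex \<Rightarrow> complex) \<Rightarrow> (complex \<Rightarrow> complex) set" where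
  "Hinf_class \<Theta> f = (PIdl\<^bsub>Hinf\<^esub> \<Theta>) +>\<^bsub>Hinf\<^esub> f"

definition quot_norm :: "(complex \<Rightarrow> complex) set \<Rightarrow> real" where
  "quot_norm C = (INF u\<in>C. sup_norm u)"

text \<open>
  The infimum over the zero set is taken in \<^typ>\<open>ereal\<close>, so that it is \<open>\<infinity>\<close> if there are no
  zeros.
\<close>

definition sharp_invertibility :: "(complex \<Rightarrow> complex) \<Rightarrow> bool" where
  "sharp_invertibility \<Theta> \<longleftrightarrow>
     (\<forall>\<epsilon>>0. \<exists>\<delta>>0. \<forall>f\<in>carrier Hinf.
        quot_norm (Hinf_class \<Theta> f) \<le> 1 \<and>
        (INF z\<in>zero_set \<Theta>. ereal (cmod (f z))) \<ge> ereal (1 - \<delta>) \<longrightarrow>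
          Hinf_class \<Theta> f \<in> Units (Hinf_quot \<Theta>) \<and>
          quot_norm (inv\<^bsub>Hinf_quot \<Theta>\<^esub> (Hinf_class \<Theta> f)) \<le> 1 + \<epsilon>)"

lemma cring_Hinf: "cring Hinf"
proof (rule cringI)
  show "abelian_group Hinf"
  proof (rule abelian_groupI)
    fix x assume x: "x \<in> carrier Hinf"
    have "(\<lambda>z. - x z) \<in> carrier Hinf" "(\<lambda>z. - x z) \<oplus>\<^bsub>Hinf\<^esub> x = \<zero>\<^bsub>Hinf\<^esub>"
      using x by (auto simp: Hinf_def bounded_iff intro!: holomorphic_intros)
    then show "\<exists>y\<in>carrier Hinf. y \<oplus>\<^bsub>Hinf\<^esub> x = \<zero>\<^bsub>Hinf\<^esub>" by blast
  next
    have "bounded ((\<lambda>z. 0::complex) ` unit_disc)" by (auto simp: bounded_iff)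
    then show "\<zero>\<^bsub>Hinf\<^esub> \<in> carrier Hinf" by (simp add: Hinf_def)
  qed (auto simp: Hinf_def fun_eq_iff algebra_simps bounded_plus_comp intro!: holomorphic_intros)
  have mult_closed: "bounded ((\<lambda>z. x z * y z) ` unit_disc)"
    if xy: "bounded (x ` unit_disc)" "bounded (y ` unit_disc)" for x y :: "complex \<Rightarrow> complex"
  proof -
    from xy obtain c d where "\<forall>z\<in>unit_disc. cmod (x z) \<le> c" "\<forall>z\<in>unit_disc. cmod (y z) \<le> d"
      by (auto simp: bounded_iff)
    then have "\<forall>z\<in>unit_disc. cmod (x z * y z) \<le> c * d"
      by (metis mult_mono' norm_ge_zero norm_mult)
    then show ?thesis by (auto simp: bounded_iff)
  qed
  have "(\<lambda>z. if z \<in> unit_disc then 1 else 0::complex) holomorphic_on unit_disc"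
    using holomorphic_transform[OF holomorphic_on_const[of 1]] by fastforce
  then show "Group.comm_monoid Hinf"
    by (intro comm_monoidI)
       (auto simp: Hinf_def fun_eq_iff algebra_simps bounded_iff mult_closed[unfolded bounded_iff, simplified]
             intro!: holomorphic_intros)
qed (auto simp: Hinf_def fun_eq_iff algebra_simps)

lemma quot_norm_Hinf_class:
  "quot_norm (Hinf_class \<Theta> f) = (INF g\<in>carrier Hinf. sup_norm (\<lambda>z. f z + g z * \<Theta> z))"
proof -
  have "Hinf_class \<Theta> f = (\<lambda>g z. f z + g z * \<Theta> z) ` carrier Hinf"
    by (auto simp: Hinf_class_def cgenideal_def a_r_coset_def' Hinf_def add.commute)
  then show ?thesis by (simp add: quot_norm_def image_image)
qed

end

theory Submission
  imports Defs "HOL-Real_Asymp.Real_Asymp"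
begin

text \<open>
  The quantitative heart is a lower bound for \<open>\<Theta>\<close> at points far from its zeros. Let \<open>w\<close> be at
  pseudohyperbolic distance at least \<open>1 - \<delta>\<close> from every zero. SIP applied to the Moebius factor
  \<open>f\<close> vanishing at \<open>w\<close> yields \<open>g, h\<close> with \<open>f g = 1 + h \<Theta>\<close> and \<open>\<parallel>g\<parallel> \<le> 1 + \<epsilon>\<close>, so that
  \<open>u = 1 + h \<Theta>\<close> is bounded by \<open>1 + \<epsilon>\<close> and vanishes at \<open>w\<close>. Pairing \<open>u (1 - cnj c \<Theta>) k\<close> with
  \<open>(c - \<Theta>) k\<close> on the circle, where \<open>c = \<Theta> w\<close> and \<open>k\<close> is the Szego kernel at \<open>w\<close>, gives
  \<open>\<bar>\<Theta> w\<bar> \<ge> 1 / (1 + \<epsilon>)\<close>.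

  By super-separation the pseudohyperbolic disc of radius \<open>1 - \<delta>\<close> around a late zero \<open>a\<^sub>k\<close> stays at
  distance at least \<open>1 - \<delta>\<close> from all other zeros. The minimum principle on this disc, applied to
  \<open>\<Theta>\<close> divided by its Blaschke factor at \<open>a\<^sub>k\<close>, gives the thinness limit. Applied to the zero-free
  factor \<open>\<Psi>\<close> of \<open>\<Theta> = B \<Psi>\<close>, it shows \<open>\<bar>\<Psi>\<bar> \<ge> 1 / (1 + \<epsilon>)\<close> near the unit circle, hence everywhere,
  so \<open>\<Psi>\<close> is a unimodular constant.
\<close>

section \<open>Inner functions and their boundary values\<close>

lemma one_minus_cnj_mult_neq_0:
  assumes "cmod z < 1" "cmod w < 1"
  shows "1 - cnj w * z \<noteq> 0"
proof
  assume "1 - cnj w * z = 0"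
  then have "cmod (cnj w * z) = 1" by simp
  moreover have "cmod w * cmod z < 1 * 1" using assms by (intro mult_strict_mono') auto
  ultimately show False by (simp add: norm_mult)
qed

text \<open>This is Cauchy's formula for \<open>F z / (1 - cnj w * z)\<close> at the point
  \<open>r\<^sup>2 * w\<close>. On the circle of radius \<open>r\<close>,
  \<open>z * cnj z = r\<^sup>2\<close> turns the Cauchy denominator into
  \<open>z * (1 - w * cnj z)\<close>, and the two denominators combine to a squared modulus: up to
  normalization, the Poisson kernel at \<open>r\<^sup>2 * w\<close>.\<close>

lemma poisson_has_integral:
  assumes F: "F holomorphic_on unit_disc" and r: "0 < r" "r < 1" and w: "cmod w < 1"
  shows "((\<lambda>t. F (of_real r * cis t) / of_real ((cmod (1 - cnj w * (of_real r * cis t)))\<^sup>2)) has_integral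
           2 * of_real pi * F (of_real (r\<^sup>2) * w) / of_real (1 - r\<^sup>2 * (cmod w)\<^sup>2)) {0..2*pi}"
proof -
  have nz: "1 - cnj w * z \<noteq> 0" if "cmod z < 1" for z
    using one_minus_cnj_mult_neq_0[OF that w] .
  define G where "G = (\<lambda>z. F z / (1 - cnj w * z))"
  have G: "G holomorphic_on unit_disc"
    unfolding G_def using nz by (intro holomorphic_intros F) auto
  have "cball 0 r \<subseteq> unit_disc" using r by auto
  then have "G holomorphic_on cball 0 r" using G holomorphic_on_subset by blast
  moreover have "r * cmod w < 1 * 1" using r w by (intro mult_strict_mono') auto
  then have "r * (r * cmod w) < r" using r by simp
  then have "cmod (of_real (r\<^sup>2) * w - 0) < r"
    using r by (simp add: norm_mult power2_eq_square)
  ultimately have "((\<lambda>u. G u / (u - of_real (r\<^sup>2) * w)) has_contour_integral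
      2 * of_real pi * \<i> * G (of_real (r\<^sup>2) * w)) (part_circlepath 0 r 0 (2*pi))"
    using Cauchy_integral_circlepath_simple[of G 0 r "of_real (r\<^sup>2) * w"]
    by (simp add: circlepath_def)
  then have "((\<lambda>t. G (0 + r * cis t) / (0 + r * cis t - of_real (r\<^sup>2) * w) * r * \<i> * cis t) has_integral
      2 * of_real pi * \<i> * G (of_real (r\<^sup>2) * w)) {0..2*pi}"
    by (subst (asm) has_contour_integral_part_circlepath_iff) auto
  \<comment> \<open>The factor \<open>- \<i>\<close> cancels the \<open>\<i>\<close> coming from the
    derivative of the circle path.\<close>
  then have I: "((\<lambda>t. (- \<i>) * (G (0 + r * cis t) / (0 + r * cis t - of_real (r\<^sup>2) * w) * r * \<i> * cis t)) has_integral
      (- \<i>) * (2 * of_real pi * \<i> * G (of_real (r\<^sup>2) * w))) {0..2*pi}"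
    by (rule has_integral_mult_right)
  have "1 - cnj w * (of_real (r\<^sup>2) * w) = of_real (1 - r\<^sup>2 * (cmod w)\<^sup>2)"
    using complex_norm_square[of w] by (simp add: algebra_simps)
  then have "G (of_real (r\<^sup>2) * w) = F (of_real (r\<^sup>2) * w) / of_real (1 - r\<^sup>2 * (cmod w)\<^sup>2)"
    by (simp only: G_def)
  moreover have "(- \<i>) * (2 * of_real pi * \<i> * x) = 2 * of_real pi * x" for x by simp
  ultimately have e1: "(- \<i>) * (2 * of_real pi * \<i> * G (of_real (r\<^sup>2) * w)) =
      2 * of_real pi * F (of_real (r\<^sup>2) * w) / of_real (1 - r\<^sup>2 * (cmod w)\<^sup>2)"
    by (simp only: times_divide_eq_right)
  have e2: "(- \<i>) * (G (0 + r * cis t) / (0 + r * cis t - of_real (r\<^sup>2) * w) * r * \<i> * cis t) =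
      F (of_real r * cis t) / of_real ((cmod (1 - cnj w * (of_real r * cis t)))\<^sup>2)" for t
  proof -
    define z where "z = of_real r * cis t"
    have z: "cmod z < 1" "z \<noteq> 0" using r by (auto simp: z_def norm_mult)
    have zz: "z * cnj z = of_real (r\<^sup>2)"
      using complex_norm_square[of z] r by (simp add: z_def norm_mult)
    have "of_real ((cmod (1 - cnj w * z))\<^sup>2) = (1 - cnj w * z) * (1 - w * cnj z)"
      by (subst complex_norm_square) simp
    then have "z * of_real ((cmod (1 - cnj w * z))\<^sup>2) = (1 - cnj w * z) * (z - w * (z * cnj z))"
      by (simp only:) (simp add: algebra_simps)
    then have *: "z * of_real ((cmod (1 - cnj w * z))\<^sup>2) = (1 - cnj w * z) * (z - of_real (r\<^sup>2) * w)"
      by (simp add: zz mult.commute)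
    have n: "of_real ((cmod (1 - cnj w * z))\<^sup>2) \<noteq> (0::complex)" using nz[OF z(1)] by simp
    then have "z - of_real (r\<^sup>2) * w \<noteq> 0" using * z by (metis mult_eq_0_iff)
    then have "F z / of_real ((cmod (1 - cnj w * z))\<^sup>2) = F z / (1 - cnj w * z) / (z - of_real (r\<^sup>2) * w) * z"
      using n nz[OF z(1)] * by (simp add: frac_eq_eq mult.commute)
    moreover have "(- \<i>) * (x * of_real r * \<i> * cis t) = x * z" for x
      by (simp add: z_def complex_eq_iff algebra_simps)
    ultimately show ?thesis by (simp only: G_def z_def add_0)
  qed
  show ?thesis using I unfolding e1 e2 .
qed

text \<open>Dominated convergence: the integrand tends to 0 wherever the radial limit has modulus 1,
  and boundedness of \<open>\<Theta>\<close> supplies a constant majorant. This is the only place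
  where radial limits are used.\<close>

lemma inner_function_radial_deviation_tendsto_0:
  assumes "inner_function \<Theta>" and r: "\<And>n. 0 < r n" "\<And>n. r n < 1" "r \<longlonglongrightarrow> 1"
  shows "(\<lambda>n. LINT t:{0..2*pi}|lborel. \<bar>1 - (cmod (\<Theta> (of_real (r n) * cis t)))\<^sup>2\<bar>) \<longlonglongrightarrow> 0"
proof -
  from assms have hol: "\<Theta> holomorphic_on unit_disc" and "bounded (\<Theta> ` unit_disc)"
    and ae: "AE t\<in>{0..2*pi} in lborel.
        \<exists>l. cmod l = 1 \<and> ((\<lambda>r. \<Theta> (complex_of_real r * cis t)) \<longlongrightarrow> l) (at_left 1)"
    by (auto simp: inner_function_def Hinf_def)
  then obtain B where B: "\<And>z. cmod z < 1 \<Longrightarrow> cmod (\<Theta> z) \<le> B"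
    unfolding bounded_iff by (metis image_eqI mem_ball_0)
  have in_disc: "of_real (r n) * cis t \<in> unit_disc" for n t
    using r(1)[of n] r(2)[of n] by (simp add: norm_mult)
  have r1: "filterlim r (at_left 1) sequentially"
    using r by (auto simp: filterlim_at less_imp_neq)
  have cont: "continuous_on {0..2*pi} (\<lambda>t. \<bar>1 - (cmod (\<Theta> (of_real (r n) * cis t)))\<^sup>2\<bar>)" for n
    by (intro continuous_intros continuous_on_compose2[OF holomorphic_on_imp_continuous_on[OF hol]])
       (use in_disc in auto)
  have "(\<lambda>n. LINT t|lborel. indicator {0..2*pi} t *\<^sub>R \<bar>1 - (cmod (\<Theta> (of_real (r n) * cis t)))\<^sup>2\<bar>)
      \<longlonglongrightarrow> integral\<^sup>L lborel (\<lambda>t::real. 0::real)"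
  proof (rule integral_dominated_convergence[where w = "\<lambda>t. indicator {0..2*pi} t * (1 + B\<^sup>2)"])
    show "(\<lambda>t. indicator {0..2*pi} t *\<^sub>R \<bar>1 - (cmod (\<Theta> (of_real (r n) * cis t)))\<^sup>2\<bar>) \<in> borel_measurable lborel" for n
      using borel_measurable_continuous_on_indicator[OF _ cont[of n]] by simp
    show "integrable lborel (\<lambda>t::real. indicator {0..2*pi} t * (1 + B\<^sup>2))"
      by (intro integrable_mult_left) auto
    show "AE t in lborel. (\<lambda>n. indicator {0..2*pi} t *\<^sub>R \<bar>1 - (cmod (\<Theta> (of_real (r n) * cis t)))\<^sup>2\<bar>) \<longlonglongrightarrow> 0"
      using ae
    proof eventually_elim
      case (elim t)
      show ?case
      proof (cases "t \<in> {0..2*pi}")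
        case True
        with elim obtain l where l: "cmod l = 1" "((\<lambda>r. \<Theta> (complex_of_real r * cis t)) \<longlongrightarrow> l) (at_left 1)"
          by auto
        have "(\<lambda>n. \<Theta> (complex_of_real (r n) * cis t)) \<longlonglongrightarrow> l"
          using filterlim_compose[OF l(2) r1] .
        then have "(\<lambda>n. \<bar>1 - (cmod (\<Theta> (of_real (r n) * cis t)))\<^sup>2\<bar>) \<longlonglongrightarrow> \<bar>1 - (cmod l)\<^sup>2\<bar>"
          by (intro tendsto_intros)
        then show ?thesis using True l by simp
      qed simp
    qed
    have "\<bar>1 - (cmod (\<Theta> (of_real (r n) * cis t)))\<^sup>2\<bar> \<le> 1 + B\<^sup>2" for n t
    proof -
      have "(cmod (\<Theta> (of_real (r n) * cis t)))\<^sup>2 \<le> B\<^sup>2"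
        using B in_disc[of n t] by (intro power_mono) auto
      moreover have "(cmod (\<Theta> (of_real (r n) * cis t)))\<^sup>2 \<ge> 0" by simp
      ultimately show ?thesis by linarith
    qed
    then show "AE t in lborel. norm (indicator {0..2*pi} t *\<^sub>R \<bar>1 - (cmod (\<Theta> (of_real (r n) * cis t)))\<^sup>2\<bar>)
        \<le> indicator {0..2*pi} t * (1 + B\<^sup>2)" for n
      by (auto simp: indicator_def)
  qed simp
  then show ?thesis by (simp add: set_lebesgue_integral_def)
qed

text \<open>
  This replaces boundary integration: an inequality that holds on the circle, where \<open>\<bar>\<Theta>\<bar> = 1\<close>, is
  stated inside the disc with an error term that vanishes as \<open>\<bar>\<Theta>\<bar>\<close> tends to \<open>1\<close>.
\<close>

lemma Re_le_of_inner_function_boundary_bound: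
  assumes "inner_function \<Theta>" and H: "H holomorphic_on unit_disc" and w: "cmod w < 1"
    and le: "\<And>z. cmod z < 1 \<Longrightarrow> Re (H z) \<le> A + K * \<bar>1 - (cmod (\<Theta> z))\<^sup>2\<bar>"
  shows "Re (H w) \<le> A"
proof -
  define r where "r = (\<lambda>n. 1 - 1 / (real n + 2))"
  have r: "0 < r n" "r n < 1" for n by (auto simp: r_def field_simps)
  have rlim: "r \<longlonglongrightarrow> 1" unfolding r_def by real_asymp
  define P where "P = (\<lambda>n t. 1 / (cmod (1 - cnj w * (of_real (r n) * cis t)))\<^sup>2)"
  define D where "D = (\<lambda>n t. \<bar>1 - (cmod (\<Theta> (of_real (r n) * cis t)))\<^sup>2\<bar>)"
  define q where "q = (\<lambda>n. 1 - (r n)\<^sup>2 * (cmod w)\<^sup>2)"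
  have hol: "\<Theta> holomorphic_on unit_disc"
    using assms by (auto simp: inner_function_def Hinf_def)
  have in_disc: "of_real (r n) * cis t \<in> unit_disc" for n t
    using r[of n] by (simp add: norm_mult)
  have IH: "((\<lambda>t. P n t * Re (H (of_real (r n) * cis t))) has_integral
      2 * pi * Re (H (of_real ((r n)\<^sup>2) * w)) / q n) {0..2*pi}" for n
    using has_integral_Re[OF poisson_has_integral[OF H r(1)[of n] r(2)[of n] w]]
    by (simp add: P_def q_def Re_divide_of_real del: of_real_power of_real_mult of_real_diff)
  \<comment> \<open>The case \<open>F = 1\<close> gives the total mass of the weight, so the
    constant \<open>A\<close> is reproduced exactly.\<close>
  have I1: "((\<lambda>t. P n t * 1) has_integral 2 * pi / q n) {0..2*pi}" for n
    using has_integral_Re[OF poisson_has_integral[OF holomorphic_on_const[of 1] r(1)[of n] r(2)[of n] w]]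
    by (simp add: P_def q_def Re_divide_of_real del: of_real_power of_real_mult of_real_diff)
  have Dc: "continuous_on {0..2*pi} (D n)" for n
    unfolding D_def
    by (intro continuous_intros continuous_on_compose2[OF holomorphic_on_imp_continuous_on[OF hol]])
       (use in_disc in auto)
  have ID: "(D n has_integral (LINT t:{0..2*pi}|lborel. D n t)) {0..2*pi}" for n
    using set_borel_integral_eq_integral[OF borel_integrable_atLeastAtMost'[OF Dc[of n]]]
    by (simp add: has_integral_integrable_integral)
  \<comment> \<open>The weight is bounded uniformly in \<open>n\<close>, so the weighted error is at
    most a constant times the unweighted integral of \<open>D n\<close>.\<close>
  have P: "P n t \<le> 1 / (1 - cmod w)\<^sup>2" "0 \<le> P n t" for n t
  proof -
    have "cmod w * r n \<le> cmod w * 1" using r[of n] by (intro mult_left_mono) auto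
    then have "cmod (cnj w * (of_real (r n) * cis t)) \<le> cmod w"
      using r[of n] by (simp add: norm_mult)
    then have "1 - cmod w \<le> cmod (1 - cnj w * (of_real (r n) * cis t))"
      using norm_triangle_ineq2[of 1 "cnj w * (of_real (r n) * cis t)"] by simp
    then show "P n t \<le> 1 / (1 - cmod w)\<^sup>2"
      unfolding P_def using w by (intro divide_left_mono power_mono mult_pos_pos) auto
  qed (auto simp: P_def)
  define C where "C = \<bar>K\<bar> / (1 - cmod w)\<^sup>2"
  have "2 * pi * Re (H (of_real ((r n)\<^sup>2) * w)) / q n \<le>
      A * (2 * pi / q n) + C * (LINT t:{0..2*pi}|lborel. D n t)" for n
  proof (rule has_integral_le[OF IH])
    show "((\<lambda>t. A * (P n t * 1) + C * D n t) has_integral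
        A * (2 * pi / q n) + C * (LINT t:{0..2*pi}|lborel. D n t)) {0..2*pi}"
      by (intro has_integral_add has_integral_mult_right I1 ID)
    fix t
    have "Re (H (of_real (r n) * cis t)) \<le> A + K * D n t"
      using le in_disc[of n t] by (simp add: D_def)
    then have "P n t * Re (H (of_real (r n) * cis t)) \<le> P n t * (A + K * D n t)"
      using P by (intro mult_left_mono)
    also have "\<dots> \<le> A * (P n t * 1) + P n t * (\<bar>K\<bar> * D n t)"
      using mult_left_mono[OF mult_right_mono[of K "\<bar>K\<bar>" "D n t"] P(2)[of n t]]
      by (simp add: algebra_simps D_def)
    also have "P n t * (\<bar>K\<bar> * D n t) \<le> 1 / (1 - cmod w)\<^sup>2 * (\<bar>K\<bar> * D n t)"
      by (intro mult_right_mono P) (auto simp: D_def)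
    finally show "P n t * Re (H (of_real (r n) * cis t)) \<le> A * (P n t * 1) + C * D n t"
      by (simp add: C_def)
  qed
  moreover have "(\<lambda>n. 2 * pi * Re (H (of_real ((r n)\<^sup>2) * w)) / q n) \<longlonglongrightarrow>
      2 * pi * Re (H (of_real (1\<^sup>2) * w)) / (1 - 1\<^sup>2 * (cmod w)\<^sup>2)"
  proof -
    have "continuous (at w) H"
      using H w by (intro holomorphic_on_imp_continuous_on[THEN continuous_on_interior]) auto
    moreover have "(\<lambda>n. of_real ((r n)\<^sup>2) * w) \<longlonglongrightarrow> of_real (1\<^sup>2) * w"
      by (intro tendsto_intros rlim)
    ultimately have "(\<lambda>n. H (of_real ((r n)\<^sup>2) * w)) \<longlonglongrightarrow> H (of_real (1\<^sup>2) * w)"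
      using isCont_tendsto_compose[of "of_real (1\<^sup>2) * w" H] by simp
    moreover have "1 - 1\<^sup>2 * (cmod w)\<^sup>2 \<noteq> 0" using w
      by (simp add: power2_eq_1_iff) (use norm_ge_zero[of w] in linarith)
    ultimately show ?thesis unfolding q_def by (intro tendsto_intros rlim)
  qed
  moreover have "(\<lambda>n. A * (2 * pi / q n) + C * (LINT t:{0..2*pi}|lborel. D n t)) \<longlonglongrightarrow>
      A * (2 * pi / (1 - 1\<^sup>2 * (cmod w)\<^sup>2)) + C * 0"
  proof -
    have "1 - 1\<^sup>2 * (cmod w)\<^sup>2 \<noteq> 0" using w
      by (simp add: power2_eq_1_iff) (use norm_ge_zero[of w] in linarith)
    moreover have "(\<lambda>n. LINT t:{0..2*pi}|lborel. D n t) \<longlonglongrightarrow> 0"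
      unfolding D_def using inner_function_radial_deviation_tendsto_0[OF assms(1) r rlim] .
    ultimately show ?thesis unfolding q_def by (intro tendsto_intros rlim)
  qed
  ultimately have "2 * pi * Re (H (of_real (1\<^sup>2) * w)) / (1 - 1\<^sup>2 * (cmod w)\<^sup>2) \<le>
      A * (2 * pi / (1 - 1\<^sup>2 * (cmod w)\<^sup>2)) + C * 0"
    by (intro LIMSEQ_le) auto
  moreover have "1 - (cmod w)\<^sup>2 > 0" using w by (simp add: power_less_one_iff abs_square_less_1)
  then have "0 < 2 * pi / (1 - (cmod w)\<^sup>2)" by simp
  ultimately have "2 * pi / (1 - (cmod w)\<^sup>2) * Re (H w) \<le> 2 * pi / (1 - (cmod w)\<^sup>2) * A" by (simp add: mult.commute)
  then show ?thesis using \<open>0 < 2 * pi / (1 - (cmod w)\<^sup>2)\<close> by (simp only: mult_le_cancel_left_pos)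
qed

text \<open>\<open>(cmod \<Theta>)\<^sup>2\<close> is not the real part of a holomorphic function,
  so the square \<open>(cmod (c - \<Theta> z))\<^sup>2\<close> is expanded instead. Its cross term
  is such a real part, and at \<open>w\<close> it equals
  \<open>2 * (cmod c)\<^sup>2\<close>.\<close>

lemma inner_function_norm_le_1:
  assumes "inner_function \<Theta>" and w: "cmod w < 1"
  shows "cmod (\<Theta> w) \<le> 1"
proof -
  define c where "c = \<Theta> w"
  have hol: "\<Theta> holomorphic_on unit_disc"
    using assms by (auto simp: inner_function_def Hinf_def)
  have "Re (2 * cnj c * \<Theta> w) \<le> 1 + (cmod c)\<^sup>2"
  proof (rule Re_le_of_inner_function_boundary_bound[OF assms(1) _ w, where K = 1])
    show "(\<lambda>z. 2 * cnj c * \<Theta> z) holomorphic_on unit_disc" by (intro holomorphic_intros hol)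
    fix z
    have "0 \<le> (cmod (c - \<Theta> z))\<^sup>2" by simp
    also have "\<dots> = (cmod c)\<^sup>2 + (cmod (\<Theta> z))\<^sup>2 - Re (2 * cnj c * \<Theta> z)"
      unfolding cmod_power2 by (simp add: algebra_simps power2_eq_square)
    finally have "Re (2 * cnj c * \<Theta> z) \<le> (cmod c)\<^sup>2 + (cmod (\<Theta> z))\<^sup>2"
      by (simp only: diff_ge_0_iff_ge)
    also have "\<dots> \<le> 1 + (cmod c)\<^sup>2 + 1 * \<bar>1 - (cmod (\<Theta> z))\<^sup>2\<bar>" by simp
    finally show "Re (2 * cnj c * \<Theta> z) \<le> 1 + (cmod c)\<^sup>2 + 1 * \<bar>1 - (cmod (\<Theta> z))\<^sup>2\<bar>" .
  qed
  moreover have "Re (2 * cnj c * \<Theta> w) = 2 * (cmod c)\<^sup>2"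
    unfolding cmod_power2 by (simp add: c_def algebra_simps power2_eq_square)
  ultimately have "(cmod c)\<^sup>2 \<le> 1" by linarith
  then show ?thesis by (simp add: c_def power_le_one_iff abs_square_le_1)
qed

text \<open>With \<open>m = cmod (\<Theta> w)\<close>, the boundary estimate for the function
  \<open>H\<close> below gives \<open>Re (H w) \<le> m * M * (1 + m\<^sup>2)\<close>. Since
  \<open>u\<close> vanishes at \<open>w\<close>, the left side is
  \<open>1 - m\<^sup>2 + 2 * m^3 * M\<close>. The difference is
  \<open>1 - m\<^sup>2 \<le> (1 - m\<^sup>2) * (M * m)\<close>.\<close>

lemma inner_function_lower_bound:
  assumes "inner_function \<Theta>" and w: "cmod w < 1"
    and h: "h holomorphic_on unit_disc" "bounded (h ` unit_disc)"
    and M: "1 \<le> M" "\<And>z. cmod z < 1 \<Longrightarrow> cmod (1 + h z * \<Theta> z) \<le> M"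
    and 0: "1 + h w * \<Theta> w = 0"
  shows "1 \<le> M * cmod (\<Theta> w)"
proof -
  define c where "c = \<Theta> w"
  define u where "u = (\<lambda>z. 1 + h z * \<Theta> z)"
  define m where "m = cmod c"
  have hol: "\<Theta> holomorphic_on unit_disc"
    using assms by (auto simp: inner_function_def Hinf_def)
  have holu: "u holomorphic_on unit_disc" unfolding u_def by (intro holomorphic_intros hol h)
  obtain B where B: "\<And>z. cmod z < 1 \<Longrightarrow> cmod (h z) \<le> B" 
    using h(2) unfolding bounded_iff by (metis image_eqI mem_ball_0)
  \<comment> \<open>On the circle \<open>Re H = Re (c u (1 - cnj c \<Theta>) cnj (c - \<Theta>)) + 2 m M Re (cnj c \<Theta>)\<close>,
    the antiholomorphic term \<open>c cnj \<Theta>\<close> having been replaced by its conjugate.\<close>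
  define H where "H = (\<lambda>z. c * cnj c * u z * (1 - cnj c * \<Theta> z) - c * h z + c * cnj c * u z
      - cnj c * \<Theta> z + 2 * of_real (m * M) * (cnj c * \<Theta> z))"
  have mm: "m\<^sup>2 = Re (c * cnj c)" "of_real (m\<^sup>2) = c * cnj c"
    unfolding m_def complex_norm_square[symmetric] by simp_all
  have "Re (H w) \<le> m * M * (1 + m\<^sup>2)"
  proof (rule Re_le_of_inner_function_boundary_bound[OF assms(1) _ w, where K = "m * M * (1 + m\<^sup>2) + m * B + m\<^sup>2 * M"])
    show "H holomorphic_on unit_disc" unfolding H_def by (intro holomorphic_intros hol holu h)
    fix z assume z: "cmod z < 1"
    define T where "T = \<Theta> z"
    define x where "x = cmod T"
    have xx: "of_real (x\<^sup>2) = T * cnj T" unfolding x_def by (rule complex_norm_square)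
    define E where "E = c * u z * (1 - cnj c * T) * cnj (c - T)"
    have uz: "u z = 1 + h z * T" by (simp add: u_def T_def)
    \<comment> \<open>Inside the disc \<open>T * cnj T\<close> is \<open>x\<^sup>2\<close> instead
      of 1. The last term records this defect and is absorbed by the error with constant
      \<open>K\<close>; the term in parentheses is purely imaginary.\<close>
    have "H z = E + (c * cnj T - cnj c * T) + 2 * of_real (m * M) * (cnj c * T)
        - (1 - of_real (x\<^sup>2)) * (c * h z - c * cnj c * u z)"
      unfolding xx E_def H_def uz T_def[symmetric] by (simp add: algebra_simps)
    moreover have "Re (c * cnj T - cnj c * T) = 0" by simp
    ultimately have RH: "Re (H z) = Re E + 2 * (m * M) * Re (cnj c * T)
        - (1 - x\<^sup>2) * Re (c * h z - c * cnj c * u z)"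
      by simp
    have "cmod E = m * cmod (u z) * (cmod (1 - cnj c * T) * cmod (c - T))"
      unfolding E_def by (simp add: norm_mult m_def flip: complex_cnj_diff)
    also have "\<dots> \<le> m * M * ((1 + m\<^sup>2) * (1 + x\<^sup>2) / 2 - 2 * Re (cnj c * T))"
    proof (intro mult_mono)
      \<comment> \<open>Where \<open>cmod T = 1\<close> the two factors have equal modulus, so
        nothing is lost on the circle.\<close>
      have "2 * (cmod (1 - cnj c * T) * cmod (c - T)) \<le> (cmod (1 - cnj c * T))\<^sup>2 + (cmod (c - T))\<^sup>2"
        using sum_squares_bound[of "cmod (1 - cnj c * T)" "cmod (c - T)"] by simp
      also have "\<dots> = (1 + m\<^sup>2) * (1 + x\<^sup>2) - 4 * Re (cnj c * T)"
        unfolding m_def x_def cmod_power2 by (simp add: algebra_simps power2_eq_square)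
      finally show "cmod (1 - cnj c * T) * cmod (c - T) \<le> (1 + m\<^sup>2) * (1 + x\<^sup>2) / 2 - 2 * Re (cnj c * T)"
        by simp
    qed (use M z in \<open>auto simp: m_def u_def\<close>)
    finally have E: "Re E \<le> m * M * ((1 + m\<^sup>2) * (1 + x\<^sup>2) / 2 - 2 * Re (cnj c * T))"
      using complex_Re_le_cmod[of E] by linarith
    have "cmod (c * h z - c * cnj c * u z) \<le> m * B + m\<^sup>2 * M"
    proof -
      have "cmod (c * h z) \<le> m * B" using B[OF z] by (simp add: norm_mult m_def mult_left_mono)
      moreover have "cmod (c * cnj c * u z) \<le> m\<^sup>2 * M"
        using M(2)[OF z] by (simp add: norm_mult m_def u_def power2_eq_square mult_left_mono)
      ultimately show ?thesis using norm_triangle_ineq4[of "c * h z" "c * cnj c * u z"] by linarith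
    qed
    define g where "g = Re (c * h z - c * cnj c * u z)"
    have "\<bar>g\<bar> \<le> m * B + m\<^sup>2 * M"
      unfolding g_def using \<open>cmod (c * h z - c * cnj c * u z) \<le> _\<close> abs_Re_le_cmod order_trans by blast
    then have "\<bar>1 - x\<^sup>2\<bar> * \<bar>g\<bar> \<le> \<bar>1 - x\<^sup>2\<bar> * (m * B + m\<^sup>2 * M)"
      by (intro mult_left_mono) auto
    then have F: "- ((1 - x\<^sup>2) * g) \<le> \<bar>1 - x\<^sup>2\<bar> * (m * B + m\<^sup>2 * M)"
      using abs_ge_minus_self[of "(1 - x\<^sup>2) * g"] by (simp only: abs_mult)
    define Q b where "Q = m * M * (1 + m\<^sup>2)" and "b = m * B + m\<^sup>2 * M"
    have "(1 + x\<^sup>2) / 2 \<le> 1 + \<bar>1 - x\<^sup>2\<bar>" by (simp add: abs_if)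
    then have Q: "Q * ((1 + x\<^sup>2) / 2) \<le> Q * (1 + \<bar>1 - x\<^sup>2\<bar>)"
      using M by (intro mult_left_mono) (auto simp: m_def Q_def)
    have "Re E \<le> Q * ((1 + x\<^sup>2) / 2) - 2 * (m * M) * Re (cnj c * T)"
      using E by (simp only: Q_def right_diff_distrib times_divide_eq_right mult.assoc mult.left_commute[of _ 2])
    then have "Re (H z) \<le> Q * (1 + \<bar>1 - x\<^sup>2\<bar>) + \<bar>1 - x\<^sup>2\<bar> * b"
      using RH[folded g_def] F[folded b_def] Q by linarith
    also have "\<dots> = Q + (Q + m * B + m\<^sup>2 * M) * \<bar>1 - x\<^sup>2\<bar>"
      by (simp add: b_def algebra_simps)
    finally show "Re (H z) \<le> m * M * (1 + m\<^sup>2) + (m * M * (1 + m\<^sup>2) + m * B + m\<^sup>2 * M) * \<bar>1 - (cmod (\<Theta> z))\<^sup>2\<bar>"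
      unfolding Q_def x_def T_def .
  qed
  moreover have "Re (H w) = 1 - m\<^sup>2 + 2 * (m * M) * m\<^sup>2"
  proof -
    have "u w = 0" using 0 by (simp add: u_def)
    moreover have "c * h w = -1" using 0 by (simp add: c_def add_eq_0_iff mult.commute)
    ultimately have "H w = 1 - cnj c * c + 2 * of_real (m * M) * (cnj c * c)"
      by (simp add: H_def flip: c_def)
    also have "cnj c * c = of_real (m\<^sup>2)" using mm by (simp add: mult.commute)
    finally show ?thesis by simp
  qed
  ultimately have "(1 - m\<^sup>2) * 1 \<le> (1 - m\<^sup>2) * (M * m)" by (simp add: algebra_simps)
  moreover have "m \<le> 1" "m \<ge> 0" using inner_function_norm_le_1[OF assms(1) w] by (simp_all add: m_def c_def)
  ultimately have "1 \<le> M * m"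
  \<comment> \<open>For \<open>m = 1\<close> the last inequality degenerates to
    \<open>0 \<le> 0\<close>, but then \<open>1 \<le> M\<close> is already the claim.\<close>
  proof (cases "m = 1")
    case False
    with \<open>m \<le> 1\<close> \<open>m \<ge> 0\<close> have "1 - m\<^sup>2 > 0" by (simp add: power_less_one_iff abs_square_less_1)
    with \<open>(1 - m\<^sup>2) * 1 \<le> (1 - m\<^sup>2) * (M * m)\<close> show ?thesis by (simp only: mult_le_cancel_left_pos)
  qed (use M in simp)
  then show ?thesis by (simp add: m_def c_def)
qed

section \<open>Pseudohyperbolic geometry and Blaschke factors\<close>

text \<open>The maximum principle for \<open>1 / f\<close>. It is applied to pseudohyperbolic discs
  after a Moebius map has moved their centre to 0.\<close>

lemma minimum_modulus_cball:
  assumes f: "f holomorphic_on unit_disc" and r: "0 < r" "r < 1"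
    and nz: "\<And>z. cmod z \<le> r \<Longrightarrow> f z \<noteq> 0"
    and m: "\<And>z. cmod z = r \<Longrightarrow> m \<le> cmod (f z)" and z: "cmod z \<le> r"
  shows "m \<le> cmod (f z)"
proof (cases "m \<le> 0")
  case False
  have "(\<lambda>z. 1 / f z) holomorphic_on cball 0 r"
    using nz r by (intro holomorphic_intros holomorphic_on_subset[OF f]) auto
  then have hol: "(\<lambda>z. 1 / f z) holomorphic_on cball 0 r" .
  have "cmod (1 / f z) \<le> 1 / m"
  proof (rule maximum_modulus_frontier[of "\<lambda>z. 1 / f z" "cball 0 r"])
    show "(\<lambda>z. 1 / f z) holomorphic_on interior (cball 0 r)"
      using hol interior_subset by (rule holomorphic_on_subset)
    show "continuous_on (closure (cball 0 r)) (\<lambda>z. 1 / f z)"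
      using holomorphic_on_imp_continuous_on[OF hol] by simp
    show "z \<in> cball 0 r" using z by simp
    fix x :: complex assume "x \<in> frontier (cball 0 r)"
    then have "m \<le> cmod (f x)" using r m by (simp add: frontier_cball)
    then show "cmod (1 / f x) \<le> 1 / m"
      using False by (simp add: norm_divide frac_le)
  qed simp
  then show ?thesis using False nz[OF z] by (simp add: norm_divide divide_simps split: if_splits)
qed (use norm_ge_zero[of "f z"] in linarith)

section \<open>The pseudohyperbolic distance\<close>

lemma pseudo_dist_eq_Moebius: "pseudo_dist z w = cmod (Moebius_function 0 w z)"
  by (simp add: pseudo_dist_def Moebius_function_simple)

lemma pseudo_dist_nonneg: "0 \<le> pseudo_dist z w"
  by (simp add: pseudo_dist_def)

lemma pseudo_dist_less_1: "cmod z < 1 \<Longrightarrow> cmod w < 1 \<Longrightarrow> pseudo_dist z w < 1"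
  by (simp add: pseudo_dist_eq_Moebius Moebius_function_norm_lt_1)

lemma pseudo_dist_commute: "pseudo_dist z w = pseudo_dist w z"
proof -
  have "cmod (1 - cnj w * z) = cmod (1 - cnj z * w)"
    by (metis complex_cnj_cnj complex_cnj_diff complex_cnj_mult complex_cnj_one complex_mod_cnj mult.commute)
  then show ?thesis by (simp add: pseudo_dist_def norm_divide norm_minus_commute)
qed

lemma one_minus_pseudo_dist_sq:
  assumes "cmod z < 1" "cmod w < 1"
  shows "1 - (pseudo_dist z w)\<^sup>2 = (1 - (cmod z)\<^sup>2) * (1 - (cmod w)\<^sup>2) / (cmod (1 - cnj w * z))\<^sup>2"
proof -
  have "(cmod (1 - cnj w * z))\<^sup>2 - (cmod (z - w))\<^sup>2 = (1 - (cmod z)\<^sup>2) * (1 - (cmod w)\<^sup>2)"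
    unfolding cmod_power2 by (simp add: algebra_simps power2_eq_square)
  moreover have "(cmod (1 - cnj w * z))\<^sup>2 \<noteq> 0" using one_minus_cnj_mult_neq_0[OF assms] by simp
  ultimately show ?thesis
    by (simp add: pseudo_dist_def norm_divide power_divide field_simps)
qed

text \<open>For fixed \<open>w\<close> the bound tends to 0 as \<open>z\<close> approaches the
  circle: a fixed zero becomes remote.\<close>

lemma one_minus_pseudo_dist_sq_le:
  assumes z: "cmod z < 1" and w: "cmod w < 1"
  shows "1 - (pseudo_dist z w)\<^sup>2 \<le> (1 - (cmod z)\<^sup>2) / (1 - cmod w)\<^sup>2"
proof -
  have "cmod w * cmod z \<le> cmod w * 1" using z by (intro mult_left_mono) auto
  then have "1 - cmod w \<le> cmod (1 - cnj w * z)"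
    using norm_triangle_ineq2[of 1 "cnj w * z"] by (simp add: norm_mult)
  moreover have "(1 - (cmod z)\<^sup>2) * (1 - (cmod w)\<^sup>2) \<le> (1 - (cmod z)\<^sup>2) * 1"
    using z by (intro mult_left_mono) (auto simp: abs_square_le_1)
  ultimately have "(1 - (cmod z)\<^sup>2) * (1 - (cmod w)\<^sup>2) / (cmod (1 - cnj w * z))\<^sup>2 \<le>
      (1 - (cmod z)\<^sup>2) / (1 - cmod w)\<^sup>2"
    using w z by (intro frac_le power_mono) (auto simp: abs_square_le_1)
  then show ?thesis using one_minus_pseudo_dist_sq[OF assms] by simp
qed

text \<open>The point \<open>q\<close> lies at distance \<open>cmod v\<close> from \<open>a\<close>;
  moving from \<open>a\<close> to \<open>q\<close> worsens the separation from \<open>b\<close> by a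
  bounded factor. The reason is that \<open>(1 - cnj b * q) * (1 + cnj a * v)\<close> equals
  \<open>(1 - cnj b * a) + v * cnj (a - b)\<close>, where
  \<open>cmod (a - b) \<le> cmod (1 - cnj b * a)\<close>.\<close>

lemma one_minus_pseudo_dist_sq_Moebius_le:
  assumes a: "cmod a < 1" and b: "cmod b < 1" and v: "cmod v < 1"
  shows "1 - (pseudo_dist (Moebius_function 0 (- a) v) b)\<^sup>2 \<le> (1 - (pseudo_dist a b)\<^sup>2) / (1 - cmod v)\<^sup>2"
proof -
  define q where "q = Moebius_function 0 (- a) v"
  have q1: "cmod q < 1" using a v by (simp add: q_def Moebius_function_norm_lt_1)
  define d where "d = cmod (1 + cnj a * v)"
  define e where "e = cmod (1 - cnj b * a)"
  have nz: "1 + cnj a * v \<noteq> 0" using one_minus_cnj_mult_neq_0[of v "- a"] a v by simp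
  have d: "d > 0" using nz by (simp add: d_def)
  have e: "e > 0" using one_minus_cnj_mult_neq_0[OF a b] by (simp add: e_def)
  have q: "q = (v + a) / (1 + cnj a * v)" by (simp add: q_def Moebius_function_simple)
  have "1 - (cmod q)\<^sup>2 = (1 - (cmod v)\<^sup>2) * (1 - (cmod a)\<^sup>2) / d\<^sup>2"
    using one_minus_pseudo_dist_sq[of v "- a"] a v by (simp add: pseudo_dist_eq_Moebius q_def d_def)
  then have *: "(1 - (cmod q)\<^sup>2) * d\<^sup>2 = (1 - (cmod v)\<^sup>2) * (1 - (cmod a)\<^sup>2)" using d by simp
  have "cmod (a - b) \<le> e"
    using pseudo_dist_less_1[OF a b] e by (simp add: pseudo_dist_def norm_divide e_def)
  then have "cmod (v * cnj (a - b)) \<le> cmod v * e" by (simp add: norm_mult mult_left_mono del: complex_cnj_diff)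
  then have "e - cmod v * e \<le> cmod ((1 - cnj b * a) + v * cnj (a - b))"
    using norm_diff_ineq[of "1 - cnj b * a" "v * cnj (a - b)"] by (simp add: e_def)
  also have "(1 - cnj b * a) + v * cnj (a - b) = (1 - cnj b * q) * (1 + cnj a * v)"
    using nz by (simp add: q field_simps)
  finally have "e * (1 - cmod v) \<le> cmod (1 - cnj b * q) * d"
    by (simp only: norm_mult d_def right_diff_distrib mult_1_right mult.commute[of e])
  then have "(e * (1 - cmod v))\<^sup>2 \<le> (cmod (1 - cnj b * q) * d)\<^sup>2"
    using e v by (intro power_mono) auto
  then have le: "e\<^sup>2 * (1 - cmod v)\<^sup>2 \<le> (cmod (1 - cnj b * q))\<^sup>2 * d\<^sup>2" by (simp add: power_mult_distrib)
  have nn: "0 \<le> 1 - (cmod v)\<^sup>2" "0 \<le> 1 - (cmod a)\<^sup>2" "0 \<le> 1 - (cmod b)\<^sup>2"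
    using a b v by (simp_all add: abs_square_le_1)
  have "1 - (pseudo_dist q b)\<^sup>2 = (1 - (cmod q)\<^sup>2) * (1 - (cmod b)\<^sup>2) / (cmod (1 - cnj b * q))\<^sup>2"
    by (rule one_minus_pseudo_dist_sq[OF q1 b])
  also have "\<dots> = (1 - (cmod q)\<^sup>2) * d\<^sup>2 * (1 - (cmod b)\<^sup>2) / ((cmod (1 - cnj b * q))\<^sup>2 * d\<^sup>2)"
    using d by simp
  also have "\<dots> = (1 - (cmod v)\<^sup>2) * (1 - (cmod a)\<^sup>2) * (1 - (cmod b)\<^sup>2) / ((cmod (1 - cnj b * q))\<^sup>2 * d\<^sup>2)"
    unfolding * ..
  also have "\<dots> \<le> 1 * (1 - (cmod a)\<^sup>2) * (1 - (cmod b)\<^sup>2) / (e\<^sup>2 * (1 - cmod v)\<^sup>2)"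
    using le e v nn by (intro frac_le mult_right_mono mult_nonneg_nonneg) auto
  also have "\<dots> = (1 - (pseudo_dist a b)\<^sup>2) / (1 - cmod v)\<^sup>2"
    by (simp add: one_minus_pseudo_dist_sq[OF a b] e_def)
  finally show ?thesis by (simp add: q_def)
qed

lemma pseudo_dist_Moebius: "cmod a < 1 \<Longrightarrow> cmod v < 1 \<Longrightarrow> pseudo_dist (Moebius_function 0 (- a) v) a = cmod v"
  by (simp add: pseudo_dist_eq_Moebius Moebius_function_compose)

lemma Moebius_function_surj:
  assumes "cmod a < 1" "cmod w < 1"
  shows "Moebius_function 0 (- a) (Moebius_function 0 a w) = w"
  by (rule Moebius_function_compose) (use assms in auto)

lemma holomorphic_on_compose_Moebius:
  assumes f: "f holomorphic_on unit_disc" and a: "cmod a < 1"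
  shows "(\<lambda>v. f (Moebius_function 0 a v)) holomorphic_on unit_disc"
proof -
  have "f \<circ> Moebius_function 0 a holomorphic_on unit_disc"
    using a by (intro holomorphic_on_compose_gen[OF Moebius_function_holomorphic f])
      (auto simp: Moebius_function_norm_lt_1)
  then show ?thesis by (simp add: o_def)
qed

section \<open>Blaschke factors and division by them\<close>

lemma blaschke_factor_eq_Moebius:
  obtains c where "cmod c = 1" "\<And>z. blaschke_factor a z = c * Moebius_function 0 a z"
proof (cases "a = 0")
  case True
  then show ?thesis by (intro that[of 1]) (auto simp: blaschke_factor_def Moebius_function_simple)
next
  case False
  have "blaschke_factor a z = - (complex_of_real (cmod a) / a) * Moebius_function 0 a z" for z
    using False by (simp add: blaschke_factor_def Moebius_function_simple divide_simps) (simp add: algebra_simps)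
  then show ?thesis using False by (intro that[of "- (complex_of_real (cmod a) / a)"]) (auto simp: norm_divide)
qed

lemma norm_blaschke_factor: "cmod (blaschke_factor a z) = pseudo_dist z a"
proof -
  obtain c where "cmod c = 1" "\<And>z. blaschke_factor a z = c * Moebius_function 0 a z"
    using blaschke_factor_eq_Moebius by blast
  then show ?thesis by (simp add: norm_mult pseudo_dist_eq_Moebius)
qed

lemma holomorphic_on_blaschke_factor:
  assumes "cmod a < 1"
  shows "blaschke_factor a holomorphic_on unit_disc"
proof -
  obtain c where "cmod c = 1" "\<And>z. blaschke_factor a z = c * Moebius_function 0 a z"
    using blaschke_factor_eq_Moebius by blast
  then have "blaschke_factor a = (\<lambda>z. c * Moebius_function 0 a z)" by auto
  then show ?thesis
    using Moebius_function_holomorphic[OF assms] by (auto intro!: holomorphic_intros)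
qed

lemma blaschke_factor_eq_0_iff:
  assumes "cmod a < 1" "cmod z < 1"
  shows "blaschke_factor a z = 0 \<longleftrightarrow> z = a"
proof -
  have "blaschke_factor a z = 0 \<longleftrightarrow> pseudo_dist z a = 0"
    by (metis norm_blaschke_factor norm_eq_zero)
  then show ?thesis
    using one_minus_cnj_mult_neq_0[of z a] assms by (simp add: pseudo_dist_def)
qed

text \<open>Because of this normalization, the thinness quantity at a zero is the modulus there of
  the cofactor of its Blaschke factor.\<close>

lemma deriv_blaschke_factor:
  assumes "cmod a < 1"
  shows "(1 - (cmod a)\<^sup>2) * cmod (deriv (blaschke_factor a) a) = 1"
proof -
  obtain c where c: "cmod c = 1" "\<And>z. blaschke_factor a z = c * Moebius_function 0 a z"
    using blaschke_factor_eq_Moebius by blast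
  have nz: "1 - cnj a * a \<noteq> 0" using one_minus_cnj_mult_neq_0 assms by blast
  have "blaschke_factor a = (\<lambda>z. c * ((z - a) / (1 - cnj a * z)))"
    using c by (auto simp: Moebius_function_simple)
  moreover have "((\<lambda>z. c * ((z - a) / (1 - cnj a * z))) has_field_derivative c / (1 - cnj a * a)) (at a)"
    using nz by (auto intro!: derivative_eq_intros simp: divide_simps)
  ultimately have "deriv (blaschke_factor a) a = c / (1 - cnj a * a)"
    by (simp add: DERIV_imp_deriv)
  moreover have "1 - cnj a * a = of_real (1 - (cmod a)\<^sup>2)"
    using complex_norm_square[of a] by (simp add: mult.commute)
  ultimately have "cmod (deriv (blaschke_factor a) a) = 1 / \<bar>1 - (cmod a)\<^sup>2\<bar>"
    using c by (simp add: norm_divide del: of_real_diff of_real_power)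
  moreover have "1 - (cmod a)\<^sup>2 > 0" using assms by (simp add: abs_square_less_1)
  ultimately show ?thesis by simp
qed

lemma zorder_blaschke_factor:
  assumes "cmod a < 1"
  shows "zorder (blaschke_factor a) a = 1"
proof (rule zorder_zero_eqI)
  show "blaschke_factor a holomorphic_on unit_disc" by (rule holomorphic_on_blaschke_factor[OF assms])
  have "deriv (blaschke_factor a) a \<noteq> 0" using deriv_blaschke_factor[OF assms] by auto
  then show "(deriv ^^ nat 1) (blaschke_factor a) a \<noteq> 0" by simp
qed (use assms in \<open>auto simp: blaschke_factor_eq_0_iff\<close>)

text \<open>After a Moebius map has moved \<open>a\<close> to 0, this is the Schwarz lemma: division
  by \<open>z\<close> preserves the bound 1.\<close>

lemma divide_blaschke_factor:
  assumes f: "f holomorphic_on unit_disc" "\<And>z. cmod z < 1 \<Longrightarrow> cmod (f z) \<le> 1"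
    and a: "cmod a < 1" "f a = 0"
  obtains g where "g holomorphic_on unit_disc" "\<And>z. cmod z < 1 \<Longrightarrow> cmod (g z) \<le> 1"
    "\<And>z. cmod z < 1 \<Longrightarrow> f z = blaschke_factor a z * g z"
proof -
  define F where "F = (\<lambda>v. f (Moebius_function 0 (- a) v))"
  have F: "F holomorphic_on unit_disc"
    unfolding F_def using f a by (intro holomorphic_on_compose_Moebius) auto
  have F0: "F 0 = 0" using a by (simp add: F_def Moebius_function_of_zero)
  have F1: "cmod (F v) \<le> 1" if "cmod v < 1" for v
    using f(2) a that by (simp add: F_def Moebius_function_norm_lt_1)
  obtain h where h: "h holomorphic_on unit_disc" "\<And>z. cmod z < 1 \<Longrightarrow> F z = z * h z" "deriv F 0 = h 0"
    using Schwarz3[OF F F0] by auto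
  have h1: "cmod (h v) \<le> 1" if v: "cmod v < 1" for v
  proof -
    \<comment> \<open>The Schwarz lemma wants a strict bound, so it is applied to
      \<open>t * F\<close> with \<open>t < 1\<close>, and \<open>t\<close> tends to 1 afterwards. At
      \<open>v = 0\<close> its derivative estimate is used.\<close>
    have "t * cmod (h v) \<le> 1" if t: "0 < t" "t < 1" for t
    proof -
      have tF: "(\<lambda>z. of_real t * F z) holomorphic_on unit_disc" by (intro holomorphic_intros F)
      have no: "cmod (of_real t * F z) < 1" if "cmod z < 1" for z
      proof -
        have "t * cmod (F z) \<le> t * 1" using t F1[OF that] by (intro mult_left_mono) auto
        then have "t * cmod (F z) < 1" using t by linarith
        then show ?thesis using t by (simp add: norm_mult)
      qed
      note S = Schwarz_Lemma[OF tF _ no v]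
      show ?thesis
      proof (cases "v = 0")
        case True
        have "F field_differentiable at 0"
          using F holomorphic_on_imp_differentiable_at[of F unit_disc 0] by simp
        then have "deriv (\<lambda>z. of_real t * F z) 0 = of_real t * deriv F 0" by simp
        then show ?thesis using S(2) True h(3) F0 t by (simp add: norm_mult)
      next
        case False
        have "t * (cmod v * cmod (h v)) \<le> cmod v"
          using S(1) F0 t h(2)[OF v] by (simp add: norm_mult)
        then have "cmod v * (t * cmod (h v)) \<le> cmod v * 1" by (simp add: mult_ac)
        then show ?thesis using False by simp
      qed
    qed
    then have "\<forall>\<^sub>F t in at_left 1. t * cmod (h v) \<le> 1"
      using eventually_at_left_real[of 0 "1::real"] by (auto elim!: eventually_mono)
    moreover have "((\<lambda>t. t * cmod (h v)) \<longlongrightarrow> 1 * cmod (h v)) (at_left 1)"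
      by (intro tendsto_intros)
    ultimately have "1 * cmod (h v) \<le> 1" by (intro tendsto_upperbound) auto
    then show ?thesis by simp
  qed
  obtain c where c: "cmod c = 1" "\<And>z. blaschke_factor a z = c * Moebius_function 0 a z"
    using blaschke_factor_eq_Moebius by blast
  have "c \<noteq> 0" using c by auto
  show ?thesis
  proof (rule that[of "\<lambda>z. h (Moebius_function 0 a z) / c"])
    show "(\<lambda>z. h (Moebius_function 0 a z) / c) holomorphic_on unit_disc"
      using \<open>c \<noteq> 0\<close> by (intro holomorphic_intros holomorphic_on_compose_Moebius h a)
    fix z assume z: "cmod z < 1"
    then have m: "cmod (Moebius_function 0 a z) < 1" using a by (simp add: Moebius_function_norm_lt_1)
    show "cmod (h (Moebius_function 0 a z) / c) \<le> 1" using h1[OF m] c by (simp add: norm_divide)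
    have "f z = F (Moebius_function 0 a z)"
      using Moebius_function_surj[OF a(1) z] by (simp add: F_def)
    then show "f z = blaschke_factor a z * (h (Moebius_function 0 a z) / c)"
      using h(2)[OF m] c(2) \<open>c \<noteq> 0\<close> by simp
  qed
qed

text \<open>Super-separation controls only pairs of late zeros. The finitely many early indices
  \<open>j\<close> are handled by letting \<open>a k\<close> approach the circle.\<close>

lemma super_separated_eventually:
  assumes sep: "super_separated N a"
    and lim: "(\<lambda>k. if enat k < N then 1 - cmod (a k) else 0) \<longlonglongrightarrow> 0" and \<eta>: "\<eta> > 0"
  shows "\<forall>\<^sub>F k in sequentially. enat k < N \<longrightarrow>
           (\<forall>j. enat j < N \<and> j \<noteq> k \<longrightarrow> 1 - (pseudo_dist (a k) (a j))\<^sup>2 \<le> \<eta>)"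
proof -
  have disc: "cmod (a k) < 1" if "enat k < N" for k using sep that by (auto simp: super_separated_def)
  obtain M where M: "\<And>j k. enat j < N \<Longrightarrow> k < j \<Longrightarrow> M \<le> k \<Longrightarrow> 1 - \<eta> / 2 \<le> pseudo_dist (a j) (a k)"
    using sep \<eta> unfolding super_separated_def by (meson half_gt_zero)
  \<comment> \<open>The choice \<open>\<eta> / 2\<close> works because
    \<open>(1 - \<eta> / 2)\<^sup>2 \<ge> 1 - \<eta>\<close>; if \<open>1 - \<eta> / 2\<close> is
    negative, \<open>\<eta>\<close> exceeds 2 and the bound is trivial.\<close>
  have sq: "1 - x\<^sup>2 \<le> \<eta>" if "1 - \<eta> / 2 \<le> x" "0 \<le> x" for x :: real
  proof (cases "1 - \<eta> / 2 \<ge> 0")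
    case True
    then have "(1 - \<eta> / 2)\<^sup>2 \<le> x\<^sup>2" using that by (intro power_mono)
    moreover have "(1 - \<eta> / 2)\<^sup>2 = 1 - \<eta> + (\<eta> / 2)\<^sup>2" by (simp add: power2_eq_square algebra_simps)
    ultimately show ?thesis using zero_le_power2[of "\<eta> / 2"] by linarith
  next
    case False
    then show ?thesis using zero_le_power2[of x] by linarith
  qed
  have "\<forall>\<^sub>F k in sequentially. enat k < N \<longrightarrow> 1 - (pseudo_dist (a k) (a j))\<^sup>2 \<le> \<eta>" if j: "enat j < N" for j
  proof -
    define C where "C = 2 / (1 - cmod (a j))\<^sup>2"
    have "(\<lambda>k. C * (if enat k < N then 1 - cmod (a k) else 0)) \<longlonglongrightarrow> C * 0"
      by (intro tendsto_intros lim)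
    then have "\<forall>\<^sub>F k in sequentially. C * (if enat k < N then 1 - cmod (a k) else 0) < \<eta>"
      using \<eta> order_tendstoD(2) by fastforce
    then show ?thesis
    proof eventually_elim
      case (elim k)
      show ?case
      proof
        assume k: "enat k < N"
        have "1 - (cmod (a k))\<^sup>2 = (1 - cmod (a k)) * (1 + cmod (a k))" by (simp add: power2_eq_square algebra_simps)
        also have "\<dots> \<le> (1 - cmod (a k)) * 2" using disc[OF k] by (intro mult_left_mono) auto
        finally have "(1 - (cmod (a k))\<^sup>2) / (1 - cmod (a j))\<^sup>2 \<le> C * (1 - cmod (a k))"
          unfolding C_def by (simp add: divide_right_mono)
        then show "1 - (pseudo_dist (a k) (a j))\<^sup>2 \<le> \<eta>"
          using one_minus_pseudo_dist_sq_le[OF disc[OF k] disc[OF j]] elim k by simp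
      qed
    qed
  qed
  then have "\<forall>\<^sub>F k in sequentially. \<forall>j\<in>{j. j < M \<and> enat j < N}. enat k < N \<longrightarrow> 1 - (pseudo_dist (a k) (a j))\<^sup>2 \<le> \<eta>"
    by (intro eventually_ball_finite) auto
  then show ?thesis using eventually_ge_at_top[of M]
  proof eventually_elim
    case (elim k)
    show ?case
    proof (intro impI allI)
      fix j assume k: "enat k < N" and j: "enat j < N \<and> j \<noteq> k"
      \<comment> \<open>The definition of super-separation orders the two indices, so the two late
        cases differ by the symmetry of the distance.\<close>
      consider "j < M" | "M \<le> j" "j < k" | "k < j" using j by linarith
      then show "1 - (pseudo_dist (a k) (a j))\<^sup>2 \<le> \<eta>"
      proof cases
        case 1 then show ?thesis using elim j k by auto
      next
        case 2 then show ?thesis using M[of k j] k by (intro sq pseudo_dist_nonneg) auto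
      next
        case 3 then show ?thesis using M[of j k] j elim by (intro sq pseudo_dist_nonneg) (auto simp: pseudo_dist_commute)
      qed
    qed
  qed
qed

section \<open>Invertibility in the quotient algebra\<close>

lemma inner_function_in_Hinf: "inner_function \<Theta> \<Longrightarrow> \<Theta> \<in> carrier Hinf"
  by (simp add: inner_function_def)

lemma Hinf_holomorphic_on: "f \<in> carrier Hinf \<Longrightarrow> f holomorphic_on unit_disc"
  by (simp add: Hinf_def)

lemma Hinf_bounded: "f \<in> carrier Hinf \<Longrightarrow> bounded (f ` unit_disc)"
  by (simp add: Hinf_def)

text \<open>If \<open>\<Theta>\<close> vanished on the disc, the deviation
  \<open>\<bar>1 - (cmod (\<Theta> z))\<^sup>2\<bar>\<close> would be 1 everywhere and dominate the
  constant function 1, although it contributes nothing in the limit.\<close>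

lemma inner_function_not_identically_0:
  assumes "inner_function \<Theta>"
  obtains w where "cmod w < 1" "\<Theta> w \<noteq> 0"
proof (rule ccontr)
  assume "\<not> thesis"
  then have "\<forall>z. cmod z < 1 \<longrightarrow> \<Theta> z = 0" using that by blast
  then have "Re 1 \<le> 0"
    using Re_le_of_inner_function_boundary_bound[OF assms holomorphic_on_const[of 1], of 0 0 1] by simp
  then show False by simp
qed

lemma norm_le_sup_norm:
  assumes "f \<in> carrier Hinf" "cmod z < 1"
  shows "cmod (f z) \<le> sup_norm f"
proof -
  have "bdd_above ((\<lambda>z. cmod (f z)) ` unit_disc)"
    using Hinf_bounded[OF assms(1)] unfolding bounded_iff bdd_above_def by blast
  then show ?thesis unfolding sup_norm_def using assms by (intro cSUP_upper) auto
qed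

lemma sup_norm_le: "(\<And>z. cmod z < 1 \<Longrightarrow> cmod (f z) \<le> B) \<Longrightarrow> sup_norm f \<le> B"
  unfolding sup_norm_def by (intro cSUP_least) auto

lemma Hinf_add_mult_closed:
  assumes "f \<in> carrier Hinf" "g \<in> carrier Hinf"
  shows "(\<lambda>z. f z + g z) \<in> carrier Hinf" "(\<lambda>z. f z * g z) \<in> carrier Hinf"
proof -
  interpret H: cring Hinf by (rule cring_Hinf)
  show "(\<lambda>z. f z + g z) \<in> carrier Hinf" using H.a_closed[OF assms] by (simp add: Hinf_def)
  show "(\<lambda>z. f z * g z) \<in> carrier Hinf" using H.m_closed[OF assms] by (simp add: Hinf_def)
qed

lemma quot_norm_Hinf_class_le:
  assumes "\<Theta> \<in> carrier Hinf" "f \<in> carrier Hinf" "\<And>z. cmod z < 1 \<Longrightarrow> cmod (f z) \<le> B"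
  shows "quot_norm (Hinf_class \<Theta> f) \<le> B"
proof -
  interpret H: cring Hinf by (rule cring_Hinf)
  have "bdd_below ((\<lambda>g. sup_norm (\<lambda>z. f z + g z * \<Theta> z)) ` carrier Hinf)"
  proof (rule bdd_belowI2)
    fix g assume "g \<in> carrier Hinf"
    then have "(\<lambda>z. f z + g z * \<Theta> z) \<in> carrier Hinf" using assms Hinf_add_mult_closed by blast
    from norm_le_sup_norm[OF this, of 0] show "0 \<le> sup_norm (\<lambda>z. f z + g z * \<Theta> z)"
      by (auto intro: order_trans[OF norm_ge_zero])
  qed
  moreover have "(\<lambda>z. 0) \<in> carrier Hinf" using H.zero_closed by (simp add: Hinf_def)
  ultimately have "quot_norm (Hinf_class \<Theta> f) \<le> sup_norm (\<lambda>z. f z + 0 * \<Theta> z)"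
    unfolding quot_norm_Hinf_class by (rule cINF_lower)
  also have "\<dots> \<le> B" using assms(3) by (intro sup_norm_le) auto
  finally show ?thesis .
qed

text \<open>SIP translated from cosets to functions: an inverse class becomes a Bezout identity
  modulo \<open>\<Theta>\<close>, with the norm bound carried by a suitable representative.\<close>

lemma sharp_invertibility_inverse:
  assumes \<Theta>: "\<Theta> \<in> carrier Hinf" and SIP: "sharp_invertibility \<Theta>" and \<epsilon>: "\<epsilon> > 0"
  obtains \<delta> where "\<delta> > 0"
    "\<And>f. f \<in> carrier Hinf \<Longrightarrow> (\<And>z. cmod z < 1 \<Longrightarrow> cmod (f z) \<le> 1) \<Longrightarrow>
       (\<And>z. z \<in> zero_set \<Theta> \<Longrightarrow> 1 - \<delta> \<le> cmod (f z)) \<Longrightarrow>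
       \<exists>g\<in>carrier Hinf. \<exists>h\<in>carrier Hinf. \<forall>z. cmod z < 1 \<longrightarrow>
         f z * g z = 1 + h z * \<Theta> z \<and> cmod (g z) \<le> 1 + \<epsilon>"
proof -
  interpret H: cring Hinf by (rule cring_Hinf)
  define I where "I = PIdl\<^bsub>Hinf\<^esub> \<Theta>"
  interpret I: ideal I Hinf unfolding I_def by (rule H.cgenideal_ideal[OF \<Theta>])
  interpret Q: ring "Hinf_quot \<Theta>" unfolding Hinf_quot_def using I.quotient_is_ring by (simp add: I_def)
  \<comment> \<open>SIP is used with \<open>\<epsilon> / 2\<close> because the infimum in the
    quotient norm need not be attained; the other half leaves room for a representative of norm
    below \<open>1 + \<epsilon>\<close>.\<close>
  from SIP \<epsilon> obtain \<delta> where \<delta>: "\<delta> > 0" and inv: "\<And>f. f \<in> carrier Hinf \<Longrightarrow>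
      quot_norm (Hinf_class \<Theta> f) \<le> 1 \<Longrightarrow> ereal (1 - \<delta>) \<le> (INF z\<in>zero_set \<Theta>. ereal (cmod (f z))) \<Longrightarrow>
      Hinf_class \<Theta> f \<in> Units (Hinf_quot \<Theta>) \<and> quot_norm (inv\<^bsub>Hinf_quot \<Theta>\<^esub> (Hinf_class \<Theta> f)) \<le> 1 + \<epsilon> / 2"
    unfolding sharp_invertibility_def by (meson half_gt_zero)
  show ?thesis
  proof (rule that[OF \<delta>])
    fix f assume f: "f \<in> carrier Hinf" and f1: "\<And>z. cmod z < 1 \<Longrightarrow> cmod (f z) \<le> 1"
      and low: "\<And>z. z \<in> zero_set \<Theta> \<Longrightarrow> 1 - \<delta> \<le> cmod (f z)"
    have "quot_norm (Hinf_class \<Theta> f) \<le> 1" using quot_norm_Hinf_class_le[OF \<Theta> f f1] by blast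
    moreover have "ereal (1 - \<delta>) \<le> (INF z\<in>zero_set \<Theta>. ereal (cmod (f z)))"
      using low by (intro INF_greatest) auto
    ultimately have unit: "Hinf_class \<Theta> f \<in> Units (Hinf_quot \<Theta>)"
      and n: "quot_norm (inv\<^bsub>Hinf_quot \<Theta>\<^esub> (Hinf_class \<Theta> f)) \<le> 1 + \<epsilon> / 2"
      using inv[OF f] by auto
    define C where "C = inv\<^bsub>Hinf_quot \<Theta>\<^esub> (Hinf_class \<Theta> f)"
    have "C \<in> carrier (Hinf_quot \<Theta>)" unfolding C_def using unit by (rule Q.Units_inv_closed)
    then obtain g0 where g0: "g0 \<in> carrier Hinf" "C = Hinf_class \<Theta> g0"
      unfolding Hinf_quot_def FactRing_def A_RCOSETS_def' Hinf_class_def by auto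
    have "Hinf_class \<Theta> f \<otimes>\<^bsub>Hinf_quot \<Theta>\<^esub> C = \<one>\<^bsub>Hinf_quot \<Theta>\<^esub>"
      unfolding C_def using unit by (rule Q.Units_r_inv)
    then have "I +>\<^bsub>Hinf\<^esub> (f \<otimes>\<^bsub>Hinf\<^esub> g0) = I +>\<^bsub>Hinf\<^esub> \<one>\<^bsub>Hinf\<^esub>"
      using I.rcoset_mult_add[OF f g0(1)]
      by (simp add: g0(2) Hinf_quot_def FactRing_def Hinf_class_def flip: I_def)
    moreover have "f \<otimes>\<^bsub>Hinf\<^esub> g0 \<in> I +>\<^bsub>Hinf\<^esub> (f \<otimes>\<^bsub>Hinf\<^esub> g0)"
      using f g0(1) by (intro I.a_rcos_self) auto
    ultimately obtain x where x: "x \<in> carrier Hinf"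
      "f \<otimes>\<^bsub>Hinf\<^esub> g0 = x \<otimes>\<^bsub>Hinf\<^esub> \<Theta> \<oplus>\<^bsub>Hinf\<^esub> \<one>\<^bsub>Hinf\<^esub>"
      unfolding I_def cgenideal_def a_r_coset_def' by auto
    have fg0: "f z * g0 z = x z * \<Theta> z + 1" if "cmod z < 1" for z
      using fun_cong[OF x(2), of z] that by (simp add: Hinf_def)
    have "(INF k\<in>carrier Hinf. sup_norm (\<lambda>z. g0 z + k z * \<Theta> z)) < 1 + \<epsilon>"
      using n \<epsilon> unfolding C_def[symmetric] g0(2) quot_norm_Hinf_class by linarith
    then obtain k where k: "k \<in> carrier Hinf" "sup_norm (\<lambda>z. g0 z + k z * \<Theta> z) < 1 + \<epsilon>"
      using H.zero_closed cInf_lessD[of "(\<lambda>k. sup_norm (\<lambda>z. g0 z + k z * \<Theta> z)) ` carrier Hinf" "1 + \<epsilon>"] by blast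
    define g where "g = (\<lambda>z. g0 z + k z * \<Theta> z)"
    \<comment> \<open>Adding \<open>k * \<Theta>\<close> to \<open>g0\<close> changes the product
      with \<open>f\<close> by \<open>f * k * \<Theta>\<close>, which is moved into
      \<open>h\<close>.\<close>
    define h where "h = (\<lambda>z. x z + f z * k z)"
    have "g \<in> carrier Hinf" "h \<in> carrier Hinf"
      unfolding g_def h_def using x g0 f k \<Theta> Hinf_add_mult_closed by blast+
    moreover have "f z * g z = 1 + h z * \<Theta> z \<and> cmod (g z) \<le> 1 + \<epsilon>" if "cmod z < 1" for z
      using fg0[OF that] norm_le_sup_norm[OF \<open>g \<in> carrier Hinf\<close> that] k(2)
      by (simp add: g_def h_def algebra_simps)
    ultimately show "\<exists>g\<in>carrier Hinf. \<exists>h\<in>carrier Hinf. \<forall>z. cmod z < 1 \<longrightarrow>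
         f z * g z = 1 + h z * \<Theta> z \<and> cmod (g z) \<le> 1 + \<epsilon>" by blast
  qed
qed

text \<open>SIP is applied to the Moebius function vanishing at \<open>w\<close>: its modulus at a
  zero of \<open>\<Theta>\<close> is the distance of that zero from \<open>w\<close>, and
  \<open>f * g\<close> vanishes at \<open>w\<close>.\<close>

lemma sharp_invertibility_lower_bound:
  assumes inner: "inner_function \<Theta>" and SIP: "sharp_invertibility \<Theta>" and \<epsilon>: "\<epsilon> > 0"
  obtains \<delta> where "0 < \<delta>" "\<delta> < 1"
    "\<And>w. cmod w < 1 \<Longrightarrow> (\<And>z. z \<in> zero_set \<Theta> \<Longrightarrow> 1 - \<delta> \<le> pseudo_dist w z) \<Longrightarrow> 1 / (1 + \<epsilon>) \<le> cmod (\<Theta> w)"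
proof -
  obtain \<delta> where \<delta>: "\<delta> > 0" and inv: "\<And>f. f \<in> carrier Hinf \<Longrightarrow> (\<And>z. cmod z < 1 \<Longrightarrow> cmod (f z) \<le> 1) \<Longrightarrow>
       (\<And>z. z \<in> zero_set \<Theta> \<Longrightarrow> 1 - \<delta> \<le> cmod (f z)) \<Longrightarrow>
       \<exists>g\<in>carrier Hinf. \<exists>h\<in>carrier Hinf. \<forall>z. cmod z < 1 \<longrightarrow>
         f z * g z = 1 + h z * \<Theta> z \<and> cmod (g z) \<le> 1 + \<epsilon>"
    using sharp_invertibility_inverse[OF inner_function_in_Hinf[OF inner] SIP \<epsilon>] by blast
  show ?thesis
  proof (rule that[of "min \<delta> (1 / 2)"])
    fix w assume w: "cmod w < 1" and far: "\<And>z. z \<in> zero_set \<Theta> \<Longrightarrow> 1 - min \<delta> (1 / 2) \<le> pseudo_dist w z"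
    define f where "f = (\<lambda>z. if z \<in> unit_disc then Moebius_function 0 w z else 0)"
    have fM: "f z = Moebius_function 0 w z" if "cmod z < 1" for z using that by (simp add: f_def)
    have f1: "cmod (f z) \<le> 1" if "cmod z < 1" for z
      using Moebius_function_norm_lt_1[OF w that, of 0] fM[OF that] by simp
    have "f holomorphic_on unit_disc"
      using Moebius_function_holomorphic[OF w, of 0] by (rule holomorphic_transform) (simp add: f_def)
    moreover have "bounded (f ` unit_disc)" unfolding bounded_iff using f1 by (intro exI[of _ 1]) auto
    ultimately have f: "f \<in> carrier Hinf" by (simp add: Hinf_def f_def)
    have "1 - \<delta> \<le> cmod (f z)" if "z \<in> zero_set \<Theta>" for z
      using far[OF that] that by (simp add: zero_set_def fM pseudo_dist_eq_Moebius[symmetric] pseudo_dist_commute[of w])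
    from inv[OF f f1 this] obtain g h where gh: "g \<in> carrier Hinf" "h \<in> carrier Hinf"
      "\<And>z. cmod z < 1 \<Longrightarrow> f z * g z = 1 + h z * \<Theta> z" "\<And>z. cmod z < 1 \<Longrightarrow> cmod (g z) \<le> 1 + \<epsilon>"
      by blast
    have "1 \<le> (1 + \<epsilon>) * cmod (\<Theta> w)"
    proof (rule inner_function_lower_bound[OF inner w Hinf_holomorphic_on[OF gh(2)] Hinf_bounded[OF gh(2)]])
      fix z assume z: "cmod z < 1"
      have "cmod (f z) * cmod (g z) \<le> 1 * (1 + \<epsilon>)" using f1[OF z] gh(4)[OF z] by (intro mult_mono) auto
      then show "cmod (1 + h z * \<Theta> z) \<le> 1 + \<epsilon>" by (simp add: norm_mult flip: gh(3)[OF z])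
    next
      show "1 + h w * \<Theta> w = 0" using gh(3)[OF w] fM[OF w] by (simp add: Moebius_function_eq_zero)
    qed (use \<epsilon> in simp)
    then show "1 / (1 + \<epsilon>) \<le> cmod (\<Theta> w)" using \<epsilon> by (simp add: divide_le_eq mult.commute)
  qed (use \<delta> in auto)
qed

section \<open>Zeros and Blaschke factorization\<close>

text \<open>The point \<open>w\<close> witnesses that \<open>f\<close> is not identically zero; the
  identity theorem then isolates the zeros, as the rules for \<open>zorder\<close> demand.\<close>

lemma eventually_nonzero_on_disc:
  assumes "f holomorphic_on unit_disc" "cmod w < 1" "f w \<noteq> 0" "cmod z < 1"
  shows "\<forall>\<^sub>F x in at z. f x \<noteq> 0 \<and> x \<in> unit_disc"
  using assms by (intro non_zero_neighbour_alt[of f unit_disc z w]) auto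

lemma zorder_mult_on_disc:
  assumes p: "p holomorphic_on unit_disc" and q: "q holomorphic_on unit_disc"
    and f: "\<And>z. cmod z < 1 \<Longrightarrow> f z = p z * q z" and w: "cmod w < 1" "f w \<noteq> 0" and z: "cmod z < 1"
  shows "zorder f z = zorder p z + zorder q z"
proof -
  have an: "p analytic_on {z}" "q analytic_on {z}"
    using p q z by (auto simp: analytic_at intro!: exI[of _ unit_disc])
  have "(\<lambda>z. p z * q z) holomorphic_on unit_disc" by (intro holomorphic_intros p q)
  then have ev: "\<forall>\<^sub>F x in at z. p x * q x \<noteq> 0 \<and> x \<in> unit_disc"
    using w f[OF w(1)] z by (intro eventually_nonzero_on_disc) auto
  then have "\<forall>\<^sub>F x in at z. f x = p x * q x" by eventually_elim (auto simp: f)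
  then have "zorder f z = zorder (\<lambda>x. p x * q x) z" by (intro zorder_cong) auto
  also have "\<dots> = zorder p z + zorder q z"
    using ev by (intro zorder_times_analytic an) (auto elim: eventually_mono)
  finally show ?thesis .
qed

lemma zorder_on_disc:
  assumes f: "f holomorphic_on unit_disc" and w: "cmod w < 1" "f w \<noteq> 0" and z: "cmod z < 1"
  shows "0 \<le> zorder f z" "0 < zorder f z \<longleftrightarrow> f z = 0"
proof -
  have an: "f analytic_on {z}" using f z by (auto simp: analytic_at intro!: exI[of _ unit_disc])
  have "\<forall>\<^sub>F x in at z. f x \<noteq> 0"
    using eventually_nonzero_on_disc[OF f w z] by (auto elim: eventually_mono)
  then have fr: "\<exists>\<^sub>F x in at z. f x \<noteq> 0" by (intro eventually_frequently) auto
  show "0 \<le> zorder f z" "0 < zorder f z \<longleftrightarrow> f z = 0"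
    using zorder_ge_0[OF an fr] zorder_pos_iff'[OF an fr] by auto
qed

lemma lists_zeros_zero_set:
  assumes "f holomorphic_on unit_disc" "cmod w < 1" "f w \<noteq> 0" "lists_zeros f N a"
  shows "zero_set f = a ` {k. enat k < N}"
proof
  show "zero_set f \<subseteq> a ` {k. enat k < N}"
  proof
    fix z assume z: "z \<in> zero_set f"
    then have "0 < zorder f z" using zorder_on_disc(2)[OF assms(1-3)] by (simp add: zero_set_def)
    moreover have "int (card {k. enat k < N \<and> a k = z}) = zorder f z"
      using assms(4) z by (simp add: lists_zeros_def)
    ultimately have "card {k. enat k < N \<and> a k = z} \<noteq> 0" by linarith
    then have "{k. enat k < N \<and> a k = z} \<noteq> {}" by (metis card.empty)
    then show "z \<in> a ` {k. enat k < N}" by auto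
  qed
qed (use assms(4) in \<open>auto simp: lists_zeros_def\<close>)

text \<open>Write \<open>f = blaschke_factor a * g\<close>; the quantity in question is
  \<open>cmod (g a)\<close>, at most 1. As the zero is simple, \<open>g\<close> has no zero on the
  pseudohyperbolic disc. On its boundary \<open>cmod f = r * cmod g\<close>, so \<open>m\<close>
  bounds \<open>cmod g\<close> from below there, and by the minimum principle also at
  \<open>a\<close>.\<close>

lemma simple_zero_derivative_bounds:
  assumes f: "f holomorphic_on unit_disc" "\<And>z. cmod z < 1 \<Longrightarrow> cmod (f z) \<le> 1"
    and a: "cmod a < 1" "zorder f a = 1" and r: "0 < r" "r < 1"
    and nz: "\<And>v. cmod v \<le> r \<Longrightarrow> v \<noteq> 0 \<Longrightarrow> f (Moebius_function 0 (- a) v) \<noteq> 0"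
    and m: "\<And>v. cmod v = r \<Longrightarrow> m \<le> cmod (f (Moebius_function 0 (- a) v))"
    and fa: "f a = 0"
  shows "m \<le> (1 - (cmod a)\<^sup>2) * cmod (deriv f a)" "(1 - (cmod a)\<^sup>2) * cmod (deriv f a) \<le> 1"
proof -
  obtain g where g: "g holomorphic_on unit_disc" "\<And>z. cmod z < 1 \<Longrightarrow> cmod (g z) \<le> 1"
    "\<And>z. cmod z < 1 \<Longrightarrow> f z = blaschke_factor a z * g z"
    using divide_blaschke_factor[OF f a(1) fa] by blast
  have Ma: "cmod (Moebius_function 0 (- a) v) < 1" if "cmod v < 1" for v
    using a that by (simp add: Moebius_function_norm_lt_1)
  define w where "w = Moebius_function 0 (- a) (of_real r)"
  have w: "cmod w < 1" "f w \<noteq> 0" using Ma[of "of_real r"] nz[of "of_real r"] r by (auto simp: w_def)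
  have gw: "g w \<noteq> 0" using g(3)[OF w(1)] w(2) by auto
  have hb: "blaschke_factor a holomorphic_on unit_disc" by (rule holomorphic_on_blaschke_factor[OF a(1)])
  have "zorder g a = 0"
    using zorder_mult_on_disc[OF hb g(1) g(3) w a(1)] zorder_blaschke_factor[OF a(1)] a(2) by simp
  then have ga: "g a \<noteq> 0" using zorder_on_disc(2)[OF g(1) w(1) gw a(1)] by simp
  define G where "G = (\<lambda>v. g (Moebius_function 0 (- a) v))"
  have G: "G holomorphic_on unit_disc" unfolding G_def using a by (intro holomorphic_on_compose_Moebius g) auto
  have G0: "G 0 = g a" by (simp add: G_def Moebius_function_of_zero)
  have "m \<le> cmod (G 0)"
  proof (rule minimum_modulus_cball[OF G r])
    fix v assume v: "cmod v \<le> r"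
    show "G v \<noteq> 0"
      using nz[OF v] g(3)[OF Ma[of v]] v r ga G0 by (cases "v = 0") (auto simp: G_def)
  next
    fix v assume v: "cmod v = r"
    then have "cmod v < 1" using r by simp
    have "cmod (f (Moebius_function 0 (- a) v)) = r * cmod (G v)"
      using g(3)[OF Ma[OF \<open>cmod v < 1\<close>]] pseudo_dist_Moebius[OF a(1) \<open>cmod v < 1\<close>] v
      by (simp add: norm_mult norm_blaschke_factor G_def)
    also have "\<dots> \<le> 1 * cmod (G v)" using r by (intro mult_right_mono) auto
    finally show "m \<le> cmod (G v)" using m[OF v] by simp
  qed (use r in simp)
  moreover have "deriv f a = deriv (blaschke_factor a) a * g a"
  proof -
    have "\<forall>\<^sub>F z in nhds a. z \<in> unit_disc" using a by (intro eventually_nhds_in_open) auto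
    then have "\<forall>\<^sub>F z in nhds a. f z = blaschke_factor a z * g z" by eventually_elim (auto intro: g)
    then have "deriv f a = deriv (\<lambda>z. blaschke_factor a z * g z) a" by (intro deriv_cong_ev) auto
    also have "\<dots> = blaschke_factor a a * deriv g a + deriv (blaschke_factor a) a * g a"
      using hb g(1) a(1) by (intro deriv_mult) (auto intro!: holomorphic_on_imp_differentiable_at[of _ unit_disc])
    finally show ?thesis using a by (simp add: blaschke_factor_eq_0_iff)
  qed
  then have "(1 - (cmod a)\<^sup>2) * cmod (deriv f a) = cmod (g a)"
    using deriv_blaschke_factor[OF a(1)] by (simp add: norm_mult flip: mult.assoc)
  ultimately show "m \<le> (1 - (cmod a)\<^sup>2) * cmod (deriv f a)" "(1 - (cmod a)\<^sup>2) * cmod (deriv f a) \<le> 1"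
    using g(2)[OF a(1)] G0 by auto
qed

section \<open>Convergence of Blaschke products\<close>

lemma norm_blaschke_factor_minus_1_le:
  assumes a: "cmod a < 1" and z: "cmod z < 1"
  shows "cmod (blaschke_factor a z - 1) \<le> (1 - cmod a) * (2 / (1 - cmod z))"
proof (cases "a = 0")
  case True
  have "cmod (z - 1) \<le> 2" using norm_triangle_ineq4[of z 1] z by simp
  also have "2 \<le> 2 / (1 - cmod z)" using z by (simp add: le_divide_eq)
  finally show ?thesis using True by (simp add: blaschke_factor_def)
next
  case False
  have nz: "1 - cnj a * z \<noteq> 0" using one_minus_cnj_mult_neq_0 a z by blast
  have aa: "a * cnj a = (of_real (cmod a))\<^sup>2" using complex_norm_square[of a] by simp
  \<comment> \<open>Clearing denominators exposes the factor \<open>1 - cmod a\<close>, the summable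
    quantity.\<close>
  have "(blaschke_factor a z - 1) * (a * (1 - cnj a * z)) = of_real (cmod a) * (a - z) - (a - (a * cnj a) * z)"
    using False nz by (simp add: blaschke_factor_def field_simps)
  also have "\<dots> = - of_real (1 - cmod a) * (a + of_real (cmod a) * z)"
    unfolding aa by (simp add: algebra_simps power2_eq_square)
  finally have "cmod (blaschke_factor a z - 1) * (cmod a * cmod (1 - cnj a * z)) =
      (1 - cmod a) * cmod (a + of_real (cmod a) * z)"
    using a by (metis abs_of_nonneg diff_ge_0_iff_ge less_imp_le norm_minus_cancel norm_mult norm_of_real)
  also have "\<dots> \<le> (1 - cmod a) * (cmod a * 2)"
  proof (intro mult_left_mono)
    have "cmod a * cmod z \<le> cmod a * 1" using z by (intro mult_left_mono) auto
    then show "cmod (a + of_real (cmod a) * z) \<le> cmod a * 2"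
      using norm_triangle_ineq[of a "of_real (cmod a) * z"] by (simp add: norm_mult)
  qed (use a in simp)
  finally have "cmod a * (cmod (blaschke_factor a z - 1) * cmod (1 - cnj a * z)) \<le> cmod a * ((1 - cmod a) * 2)"
    by (simp add: mult_ac)
  then have le: "cmod (blaschke_factor a z - 1) * cmod (1 - cnj a * z) \<le> (1 - cmod a) * 2"
    using False by simp
  have "cmod a * cmod z \<le> 1 * cmod z" using a by (intro mult_right_mono) auto
  then have "1 - cmod z \<le> cmod (1 - cnj a * z)"
    using norm_triangle_ineq2[of 1 "cnj a * z"] by (simp add: norm_mult)
  then have "cmod (blaschke_factor a z - 1) * (1 - cmod z) \<le> cmod (blaschke_factor a z - 1) * cmod (1 - cnj a * z)"
    by (intro mult_left_mono) auto
  with le have "cmod (blaschke_factor a z - 1) * (1 - cmod z) \<le> (1 - cmod a) * 2" by simp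
  then show ?thesis using z by (simp add: field_simps)
qed

text \<open>A converse estimate: a lower bound for the product at one point makes the numbers
  \<open>1 - cmod a\<close> summable. The constant 8 is \<open>2\<^sup>2\<close> from
  \<open>cmod (1 - cnj a * z) \<le> 2\<close> times 2 from \<open>1 + p \<le> 2\<close>.\<close>

lemma one_minus_norm_blaschke_factor_ge:
  assumes a: "cmod a < 1" and z: "cmod z < 1"
  shows "1 - cmod a \<le> 8 / (1 - (cmod z)\<^sup>2) * (1 - cmod (blaschke_factor a z))"
proof -
  define p where "p = pseudo_dist z a"
  have p: "0 \<le> p" "p < 1" using pseudo_dist_nonneg pseudo_dist_less_1[OF z a] by (auto simp: p_def)
  have z2: "0 < 1 - (cmod z)\<^sup>2" using z by (simp add: abs_square_less_1)
  have nz: "0 < cmod (1 - cnj a * z)" using one_minus_cnj_mult_neq_0[OF z a] by simp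
  have "cmod a * cmod z \<le> 1 * 1" using a z by (intro mult_mono) auto
  then have "cmod (1 - cnj a * z) \<le> 2" using norm_triangle_ineq4[of 1 "cnj a * z"] by (simp add: norm_mult)
  then have "(cmod (1 - cnj a * z))\<^sup>2 \<le> 2\<^sup>2" by (intro power_mono) auto
  moreover have "1 - cmod a \<le> 1 - (cmod a)\<^sup>2"
    using a by (simp add: power2_eq_square mult_left_le_one_le)
  ultimately have "(1 - (cmod z)\<^sup>2) * (1 - cmod a) / 2\<^sup>2 \<le> 1 - p\<^sup>2"
    unfolding p_def one_minus_pseudo_dist_sq[OF z a] using z2 a nz z
    by (intro frac_le mult_left_mono mult_nonneg_nonneg) (auto simp: abs_square_le_1)
  also have "1 - p\<^sup>2 = (1 - p) * (1 + p)" by (simp add: power2_eq_square algebra_simps)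
  also have "\<dots> \<le> (1 - p) * 2" using p by (intro mult_left_mono) auto
  finally have "(1 - (cmod z)\<^sup>2) * (1 - cmod a) \<le> 8 * (1 - p)" by simp
  then show ?thesis using z2 by (simp add: norm_blaschke_factor field_simps flip: p_def)
qed

lemma prodinf_on_disc:
  fixes c :: "nat \<Rightarrow> complex \<Rightarrow> complex"
  assumes c: "\<And>k. c k holomorphic_on unit_disc" and s: "summable s"
    and le: "\<And>k z. cmod z < 1 \<Longrightarrow> cmod (c k z - 1) \<le> s k * (2 / (1 - cmod z))"
  shows convergent_prod_on_disc: "\<And>z. cmod z < 1 \<Longrightarrow> convergent_prod (\<lambda>k. c k z)"
    and holomorphic_on_prodinf_disc: "(\<lambda>z. \<Prod>k. c k z) holomorphic_on unit_disc"
proof -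
  show conv: "convergent_prod (\<lambda>k. c k z)" if z: "cmod z < 1" for z
  proof -
    have "summable (\<lambda>k. norm (c k z - 1))"
      by (rule summable_comparison_test'[OF summable_mult2[OF s, of "2 / (1 - cmod z)"], of 0]) (use le[OF z] in auto)
    then show ?thesis
      by (intro abs_convergent_prod_imp_convergent_prod summable_imp_abs_convergent_prod)
  qed
  \<comment> \<open>\<open>convergent_prod_LIMSEQ\<close> multiplies over \<open>{..n}\<close>; the
    shift by one passes to \<open>{..<n}\<close>.\<close>
  have lim: "(\<lambda>n. \<Prod>k<n. c k z) \<longlonglongrightarrow> (\<Prod>k. c k z)" if "cmod z < 1" for z
    using convergent_prod_LIMSEQ[OF conv[OF that]] by (subst filterlim_sequentially_Suc[symmetric]) (simp add: lessThan_Suc_atMost)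
  show "(\<lambda>z. \<Prod>k. c k z) holomorphic_on unit_disc"
  proof (rule holomorphic_uniform_sequence)
    fix x :: complex assume "x \<in> unit_disc"
    then obtain d where d: "0 < d" "cball x d \<subseteq> unit_disc"
      using open_contains_cball[of unit_disc] by blast
    have "uniformly_convergent_on (cball x d) (\<lambda>n z. \<Prod>k<n. c k z)"
    proof (rule uniformly_convergent_on_prod')
      show "continuous_on (cball x d) (c k)" for k
        using c d holomorphic_on_imp_continuous_on holomorphic_on_subset by blast
      \<comment> \<open>A point of largest modulus in the closed disc provides one majorant for the
        whole disc.\<close>
      have "\<exists>y\<in>cball x d. \<forall>z\<in>cball x d. cmod z \<le> cmod y"
        using d by (intro continuous_attains_sup) (auto intro: continuous_intros)
      then obtain y where y: "y \<in> cball x d" "\<And>z. z \<in> cball x d \<Longrightarrow> cmod z \<le> cmod y"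
        by blast
      have y1: "cmod y < 1" using y d by auto
      show "uniformly_convergent_on (cball x d) (\<lambda>n z. \<Sum>k<n. norm (c k z - 1))"
      proof (rule Weierstrass_m_test')
        show "summable (\<lambda>k. s k * (2 / (1 - cmod y)))" by (intro summable_mult2 s)
        fix k z assume z: "z \<in> cball x d"
        then have z1: "cmod z < 1" using d by auto
        have "0 \<le> s k * (2 / (1 - cmod z))" using le[OF z1, of k] norm_ge_zero order_trans by blast
        then have sk: "0 \<le> s k" using z1 by (simp add: zero_le_mult_iff zero_le_divide_iff)
        have "2 / (1 - cmod z) \<le> 2 / (1 - cmod y)" using y(2)[OF z] y1 by (intro divide_left_mono) auto
        then have "s k * (2 / (1 - cmod z)) \<le> s k * (2 / (1 - cmod y))" using sk by (intro mult_left_mono)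
        then show "norm (norm (c k z - 1)) \<le> s k * (2 / (1 - cmod y))" using le[OF z1, of k] by simp
      qed
    qed simp
    then obtain l where l: "uniform_limit (cball x d) (\<lambda>n z. \<Prod>k<n. c k z) l sequentially"
      by (auto simp: uniformly_convergent_on_def)
    have "l z = (\<Prod>k. c k z)" if "z \<in> cball x d" for z
      using tendsto_uniform_limitI[OF l that] lim[of z] that d LIMSEQ_unique by (metis mem_ball_0 subsetD)
    then have "uniform_limit (cball x d) (\<lambda>n z. \<Prod>k<n. c k z) l sequentially \<longleftrightarrow>
        uniform_limit (cball x d) (\<lambda>n z. \<Prod>k<n. c k z) (\<lambda>z. \<Prod>k. c k z) sequentially"
      by (intro uniform_limit_cong) auto
    with l have "uniform_limit (cball x d) (\<lambda>n z. \<Prod>k<n. c k z) (\<lambda>z. \<Prod>k. c k z) sequentially"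
      by blast
    then show "\<exists>d>0. cball x d \<subseteq> unit_disc \<and>
        uniform_limit (cball x d) (\<lambda>n z. \<Prod>k<n. c k z) (\<lambda>z. \<Prod>k. c k z) sequentially"
      using d by blast
  qed (use c in \<open>auto intro!: holomorphic_intros\<close>)
qed

text \<open>Each factor satisfies \<open>x k \<le> exp (- (1 - x k))\<close>; multiply and take
  logarithms.\<close>

lemma prod_ge_imp_sum_le:
  fixes x :: "'a \<Rightarrow> real"
  assumes "0 < c" "c \<le> (\<Prod>k\<in>A. x k)" "\<And>k. k \<in> A \<Longrightarrow> 0 \<le> x k"
  shows "(\<Sum>k\<in>A. 1 - x k) \<le> - ln c"
proof (cases "finite A")
  case True
  have "c \<le> (\<Prod>k\<in>A. exp (- (1 - x k)))"
    by (rule order_trans[OF assms(2)]) (intro prod_mono conjI assms(3), auto intro: order_trans[OF _ exp_ge_add_one_self])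
  also have "\<dots> = exp (- (\<Sum>k\<in>A. 1 - x k))" using True by (simp add: exp_sum sum_negf[symmetric])
  finally have "exp (ln c) \<le> exp (- (\<Sum>k\<in>A. 1 - x k))" using assms(1) by simp
  then have "ln c \<le> - (\<Sum>k\<in>A. 1 - x k)" by (simp only: exp_le_cancel_iff)
  then show ?thesis by simp
next
  \<comment> \<open>Over an infinite \<open>A\<close> the product is 1 and the sum 0 by convention,
    so \<open>c \<le> 1\<close> suffices.\<close>
  case False
  then show ?thesis using assms by simp
qed

text \<open>The zeros are divided out one after another. The cofactors \<open>g n\<close> stay
  bounded by 1, and their limit is the zero-free factor \<open>\<Psi>\<close>. Indices from
  \<open>N\<close> on contribute the factor 1.\<close>

lemma blaschke_factorization:
  assumes f: "f holomorphic_on unit_disc" "\<And>z. cmod z < 1 \<Longrightarrow> cmod (f z) \<le> 1"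
    and w: "cmod w < 1" "f w \<noteq> 0" and zeros: "lists_zeros f N a"
  defines "b \<equiv> \<lambda>k z. if enat k < N then blaschke_factor (a k) z else 1"
  obtains \<Psi> where "summable (\<lambda>k. if enat k < N then 1 - cmod (a k) else 0)"
    "\<Psi> holomorphic_on unit_disc" "\<And>z. cmod z < 1 \<Longrightarrow> cmod (\<Psi> z) \<le> 1"
    "\<And>z. cmod z < 1 \<Longrightarrow> \<Psi> z \<noteq> 0"
    "\<And>z. cmod z < 1 \<Longrightarrow> f z = (\<Prod>k. b k z) * \<Psi> z" "\<And>z. cmod z < 1 \<Longrightarrow> cmod (f z) \<le> cmod (\<Psi> z)"
proof -
  have disc: "cmod (a k) < 1" if "enat k < N" for k
    using zeros that by (auto simp: lists_zeros_def zero_set_def)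
  have hb: "b k holomorphic_on unit_disc" for k
  proof (cases "enat k < N")
    case True
    then show ?thesis using holomorphic_on_blaschke_factor[OF disc[OF True]] by (simp add: b_def)
  qed (simp add: b_def)
  have b1: "cmod (b k z) \<le> 1" if "cmod z < 1" for k z
    using pseudo_dist_less_1[OF that disc] by (auto simp: b_def norm_blaschke_factor less_imp_le)
  define cnt where "cnt = (\<lambda>n z. card {k. k < n \<and> enat k < N \<and> a k = z})"
  \<comment> \<open>The invariant tracks how much of each multiplicity is left after
    \<open>n\<close> divisions. The clause for \<open>n = 0\<close> pins the start to
    \<open>f\<close>, since dependent choice only asserts that some start exists.\<close>
  define P where "P = (\<lambda>n g. (n = (0::nat) \<longrightarrow> g = f) \<and> g holomorphic_on unit_disc \<and> (\<forall>z. cmod z < 1 \<longrightarrow> cmod (g z) \<le> 1) \<and> g w \<noteq> 0 \<and>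
      (\<forall>z. cmod z < 1 \<longrightarrow> zorder g z = zorder f z - int (cnt n z)))"
  have zorder_f: "zorder f z = int (card {k. enat k < N \<and> a k = z}) \<and> finite {k. enat k < N \<and> a k = z}"
    if "cmod z < 1" for z
  proof (cases "f z = 0")
    case True
    then show ?thesis using zeros that by (auto simp: lists_zeros_def zero_set_def)
  next
    case False
    then have e: "{k. enat k < N \<and> a k = z} = {}" using zeros by (auto simp: lists_zeros_def zero_set_def)
    show ?thesis using zorder_on_disc[OF f(1) w that] False unfolding e by auto
  qed
  have "\<exists>g. \<forall>n. P n (g n) \<and> (\<forall>z. cmod z < 1 \<longrightarrow> g n z = b n z * g (Suc n) z)"
  proof (rule dependent_nat_choice)
    show "\<exists>g. P 0 g" using f w by (intro exI[of _ f]) (simp add: P_def cnt_def)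
    fix g n assume g: "P n g"
    show "\<exists>g'. P (Suc n) g' \<and> (\<forall>z. cmod z < 1 \<longrightarrow> g z = b n z * g' z)"
    proof (cases "enat n < N")
      case False
      then have "cnt (Suc n) z = cnt n z" for z
        unfolding cnt_def by (intro arg_cong[where f = card]) (auto simp: less_Suc_eq)
      then show ?thesis using g False by (intro exI[of _ g]) (simp add: P_def b_def)
    next
      case True
      have cnt_Suc: "cnt (Suc n) z = cnt n z + (if z = a n then 1 else 0)" for z
      proof -
        have "{k. k < Suc n \<and> enat k < N \<and> a k = z} =
          (if z = a n then insert n {k. k < n \<and> enat k < N \<and> a k = z} else {k. k < n \<and> enat k < N \<and> a k = z})"
          using True by (auto simp: less_Suc_eq)
        then show ?thesis by (simp add: cnt_def)
      qed
      \<comment> \<open>Index \<open>n\<close> itself has not been counted yet, so some multiplicity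
        remains at \<open>a n\<close> and \<open>g\<close> still vanishes there.\<close>
      have "cnt n (a n) < card {k. enat k < N \<and> a k = a n}"
        unfolding cnt_def using True zorder_f[OF disc[OF True]] by (intro psubset_card_mono) auto
      then have "0 < zorder g (a n)"
        using g disc[OF True] zorder_f[OF disc[OF True]] by (simp add: P_def)
      then have "g (a n) = 0"
        using g zorder_on_disc(2)[of g w "a n"] w disc[OF True] by (simp add: P_def)
      then obtain g' where g': "g' holomorphic_on unit_disc" "\<And>z. cmod z < 1 \<Longrightarrow> cmod (g' z) \<le> 1"
        "\<And>z. cmod z < 1 \<Longrightarrow> g z = blaschke_factor (a n) z * g' z"
        using divide_blaschke_factor[of g "a n"] g disc[OF True] unfolding P_def by blast
      have hbl: "blaschke_factor (a n) holomorphic_on unit_disc" by (rule holomorphic_on_blaschke_factor[OF disc[OF True]])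
      have "zorder g' z = zorder f z - int (cnt (Suc n) z)" if z: "cmod z < 1" for z
      proof -
        define e :: nat where "e = (if z = a n then 1 else 0)"
        have "zorder (blaschke_factor (a n)) z = int e"
        proof (cases "z = a n")
          case False
          have "blaschke_factor (a n) analytic_on {z}"
            using hbl z by (auto simp: analytic_at intro!: exI[of _ unit_disc])
          then have "zorder (blaschke_factor (a n)) z = 0"
            using False z disc[OF True] by (intro zorder_eq_0I) (auto simp: blaschke_factor_eq_0_iff)
          then show ?thesis using False by (simp add: e_def)
        qed (simp add: e_def zorder_blaschke_factor[OF disc[OF True]])
        moreover have "zorder g z = zorder (blaschke_factor (a n)) z + zorder g' z"
          using g w by (intro zorder_mult_on_disc[OF hbl g'(1,3) w(1) _ z]) (auto simp: P_def)
        moreover have "zorder g z = zorder f z - int (cnt n z)" using g z by (simp add: P_def)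
        ultimately show ?thesis unfolding cnt_Suc e_def[symmetric] by linarith
      qed
      moreover have "g' w \<noteq> 0" using g g'(3)[OF w(1)] by (auto simp: P_def)
      ultimately show ?thesis using g' True by (intro exI[of _ g']) (auto simp: P_def b_def)
    qed
  qed
  then obtain g where Pg: "\<And>n. P n (g n)" and step: "\<And>n z. cmod z < 1 \<Longrightarrow> g n z = b n z * g (Suc n) z"
    by blast
  have g0: "g 0 = f" using Pg[of 0] by (simp add: P_def)
  have g1: "cmod (g n z) \<le> 1" if "cmod z < 1" for n z using Pg that by (simp add: P_def)
  \<comment> \<open>Starting at an arbitrary \<open>m\<close> relates \<open>g m\<close> to the
    later cofactors through the tail of the product.\<close>
  have gm: "g m z = (\<Prod>k<n. b (k + m) z) * g (n + m) z" if "cmod z < 1" for m n z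
  proof (induction n)
    case (Suc n)
    then show ?case using step[OF that, of "n + m"] by (simp add: mult_ac)
  qed simp
  have fg: "f z = (\<Prod>k<n. b k z) * g n z" if "cmod z < 1" for n z
    using gm[OF that, of 0 n] g0 by simp
  define s where "s = (\<lambda>k. if enat k < N then 1 - cmod (a k) else 0)"
  \<comment> \<open>Every partial product has modulus at least \<open>cmod (f w) > 0\<close> at
    \<open>w\<close>, because the cofactors are bounded by 1. This bounds the partial sums of
    \<open>1 - cmod (b k w)\<close>, hence those of \<open>s\<close>.\<close>
  have s: "summable s"
  proof (rule summableI_nonneg_bounded)
    show "0 \<le> s k" for k using less_imp_le[OF disc, of k] by (simp add: s_def)
    define C where "C = 8 / (1 - (cmod w)\<^sup>2)"
    have C: "0 \<le> C" using w(1) by (simp add: C_def abs_square_le_1)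
    have "s k \<le> C * (1 - cmod (b k w))" for k
      using one_minus_norm_blaschke_factor_ge[OF disc w(1), of k] by (simp add: s_def b_def C_def)
    then have "(\<Sum>k<n. s k) \<le> C * (\<Sum>k<n. 1 - cmod (b k w))" for n
      by (simp add: sum_distrib_left sum_mono)
    also have "C * (\<Sum>k<n. 1 - cmod (b k w)) \<le> C * - ln (cmod (f w))" for n
    proof (intro mult_left_mono C prod_ge_imp_sum_le)
      have "cmod (f w) = (\<Prod>k<n. cmod (b k w)) * cmod (g n w)"
        using fg[OF w(1), of n] by (simp add: norm_mult prod_norm)
      also have "\<dots> \<le> (\<Prod>k<n. cmod (b k w)) * 1"
        using g1[OF w(1)] by (intro mult_left_mono prod_nonneg) auto
      finally show "cmod (f w) \<le> (\<Prod>k<n. cmod (b k w))" by simp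
    qed (use w in auto)
    finally show "(\<Sum>k<n. s k) \<le> C * - ln (cmod (f w))" for n .
  qed
  have bs: "cmod (b k z - 1) \<le> s k * (2 / (1 - cmod z))" if "cmod z < 1" for k z
    using norm_blaschke_factor_minus_1_le[OF disc that, of k] by (simp add: b_def s_def)
  define T where "T = (\<lambda>m z. \<Prod>k. b (k + m) z)"
  have conv: "convergent_prod (\<lambda>k. b (k + m) z)" if "cmod z < 1" for m z
    by (rule convergent_prod_on_disc[where s = "\<lambda>k. s (k + m)"]) (use hb s bs that in \<open>auto simp: summable_iff_shift\<close>)
  have hT: "T m holomorphic_on unit_disc" for m
    unfolding T_def
    by (rule holomorphic_on_prodinf_disc[where s = "\<lambda>k. s (k + m)"]) (use hb s bs in \<open>auto simp: summable_iff_shift\<close>)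
  have limT: "(\<lambda>n. \<Prod>k<n. b (k + m) z) \<longlonglongrightarrow> T m z" if "cmod z < 1" for m z
    using convergent_prod_LIMSEQ[OF conv[OF that, of m]] unfolding T_def
    by (subst filterlim_sequentially_Suc[symmetric]) (simp add: lessThan_Suc_atMost)
  define \<Psi> where "\<Psi> = (\<lambda>z. lim (\<lambda>n. g n z))"
  \<comment> \<open>On a smaller disc only finitely many zeros remain, so there \<open>\<Psi>\<close> is the holomorphic quotient
    \<open>g m / T m\<close>.\<close>
  have local: "\<exists>m. \<forall>z. cmod z < R \<longrightarrow> T m z \<noteq> 0 \<and> g m z \<noteq> 0 \<and> (\<lambda>n. g n z) \<longlonglongrightarrow> g m z / T m z"
    if R: "R < 1" for R
  proof -
    \<comment> \<open>From some index on, every listed zero has modulus greater than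
      \<open>R\<close>.\<close>
    have "\<forall>\<^sub>F k in sequentially. s k < 1 - R"
      using summable_LIMSEQ_zero[OF s] R by (intro order_tendstoD) auto
    then obtain m where m: "\<And>k. k \<ge> m \<Longrightarrow> s k < 1 - R" by (auto simp: eventually_sequentially)
    show ?thesis
    proof (intro exI[of _ m] allI impI)
      fix z assume zR: "cmod z < R"
      then have z: "cmod z < 1" using R by simp
      have ne: "a k \<noteq> z" if "enat k < N" "k \<ge> m" for k using m[OF that(2)] that(1) zR by (auto simp: s_def)
      have "b (k + m) z \<noteq> 0" for k
        using ne[of "k + m"] disc[of "k + m"] z by (auto simp: b_def blaschke_factor_eq_0_iff)
      then have T0: "T m z \<noteq> 0" unfolding T_def by (intro prodinf_nonzero conv z)
      have "{k. enat k < N \<and> a k = z} = {k. k < m \<and> enat k < N \<and> a k = z}"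
        using ne by (metis linorder_not_less)
      then have "zorder (g m) z = 0" using Pg[of m] z zorder_f[OF z] by (simp add: P_def cnt_def)
      then have "g m z \<noteq> 0" using zorder_on_disc(2)[of "g m" w z] Pg[of m] w z by (auto simp: P_def)
      moreover have "(\<lambda>n. g n z) \<longlonglongrightarrow> g m z / T m z"
      proof (rule LIMSEQ_offset[where k = m])
        have "(\<lambda>n. g m z / (\<Prod>k<n. b (k + m) z)) \<longlonglongrightarrow> g m z / T m z"
          by (intro tendsto_intros limT z T0)
        moreover have "g m z / (\<Prod>k<n. b (k + m) z) = g (n + m) z" for n
          using gm[OF z, of m n] \<open>g m z \<noteq> 0\<close> by (auto simp: field_simps)
        ultimately show "(\<lambda>n. g (n + m) z) \<longlonglongrightarrow> g m z / T m z" by simp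
      qed
      ultimately show "T m z \<noteq> 0 \<and> g m z \<noteq> 0 \<and> (\<lambda>n. g n z) \<longlonglongrightarrow> g m z / T m z"
        using T0 by simp
    qed
  qed
  have lim\<Psi>: "(\<lambda>n. g n z) \<longlonglongrightarrow> \<Psi> z \<and> \<Psi> z \<noteq> 0" if z: "cmod z < 1" for z
  proof -
    obtain R where "cmod z < R" "R < 1" using z dense by blast
    then obtain m where "T m z \<noteq> 0 \<and> g m z \<noteq> 0 \<and> (\<lambda>n. g n z) \<longlonglongrightarrow> g m z / T m z"
      using local by blast
    moreover from this have "\<Psi> z = g m z / T m z" unfolding \<Psi>_def by (intro limI) auto
    ultimately show ?thesis by simp
  qed
  show ?thesis
  proof (rule that)
    show "summable (\<lambda>k. if enat k < N then 1 - cmod (a k) else 0)" using s by (simp add: s_def)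
    show "\<Psi> holomorphic_on unit_disc"
    proof -
      have "\<Psi> field_differentiable at z" if "z \<in> unit_disc" for z
      proof -
        obtain R where R: "cmod z < R" "R < 1" using \<open>z \<in> unit_disc\<close> dense by auto
        obtain m where m: "\<And>x. cmod x < R \<Longrightarrow> T m x \<noteq> 0 \<and> (\<lambda>n. g n x) \<longlonglongrightarrow> g m x / T m x"
          using local[OF R(2)] by blast
        have "ball 0 R \<subseteq> unit_disc" using R by auto
        then have "(\<lambda>x. g m x / T m x) holomorphic_on ball 0 R"
          using m Pg[of m] hT[of m] by (intro holomorphic_intros) (auto simp: P_def elim: holomorphic_on_subset)
        moreover have "g m x / T m x = \<Psi> x" if "x \<in> ball 0 R" for x
          using m[of x] that unfolding \<Psi>_def by (intro limI[symmetric]) auto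
        ultimately have "\<Psi> holomorphic_on ball 0 R" by (rule holomorphic_transform)
        then show ?thesis using R by (intro holomorphic_on_imp_differentiable_at[of _ "ball 0 R"]) auto
      qed
      then show ?thesis by (simp add: holomorphic_on_def field_differentiable_at_within)
    qed
    fix z assume z: "cmod z < 1"
    have L: "(\<lambda>n. g n z) \<longlonglongrightarrow> \<Psi> z" "\<Psi> z \<noteq> 0" using lim\<Psi>[OF z] by auto
    show "\<Psi> z \<noteq> 0" by fact
    show "cmod (\<Psi> z) \<le> 1" using g1[OF z] by (intro LIMSEQ_le_const2[OF tendsto_norm[OF L(1)]]) auto
    have "(\<lambda>n. (\<Prod>k<n. b (k + 0) z) * g n z) \<longlonglongrightarrow> T 0 z * \<Psi> z" by (intro tendsto_mult limT z L)
    then have "(\<lambda>n. f z) \<longlonglongrightarrow> T 0 z * \<Psi> z" using fg[OF z] by simp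
    then have "f z = T 0 z * \<Psi> z" by (rule LIMSEQ_unique[OF tendsto_const])
    then show "f z = (\<Prod>k. b k z) * \<Psi> z" by (simp add: T_def)
    have "cmod (f z) \<le> cmod (g n z)" for n
    proof -
      have "(\<Prod>k<n. cmod (b k z)) \<le> 1" using b1[OF z] by (intro prod_le_1) auto
      then have "(\<Prod>k<n. cmod (b k z)) * cmod (g n z) \<le> 1 * cmod (g n z)" by (intro mult_right_mono) auto
      then show ?thesis using fg[OF z, of n] by (simp add: norm_mult prod_norm)
    qed
    then show "cmod (f z) \<le> cmod (\<Psi> z)" by (intro LIMSEQ_le_const[OF tendsto_norm[OF L(1)]]) auto
  qed
qed

section \<open>Thinness\<close>

text \<open>The squared distances tend to 1 at the circle, uniformly over the finite set;
  \<open>p\<^sup>2 \<le> p\<close> for \<open>p\<close> in the unit interval avoids a square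
  root.\<close>

lemma pseudo_dist_near_circle_finite:
  assumes fin: "finite Z" "\<And>z. z \<in> Z \<Longrightarrow> cmod z < 1" and \<delta>: "0 < \<delta>"
  obtains R where "0 < R" "R < 1" "\<And>w z. R \<le> cmod w \<Longrightarrow> cmod w < 1 \<Longrightarrow> z \<in> Z \<Longrightarrow> 1 - \<delta> \<le> pseudo_dist w z"
proof -
  have "\<forall>\<^sub>F s in at_left 1. (1 - s\<^sup>2) / (1 - cmod z)\<^sup>2 < \<delta>" if "z \<in> Z" for z
  proof -
    have "((\<lambda>s. (1 - s\<^sup>2) / (1 - cmod z)\<^sup>2) \<longlongrightarrow> (1 - 1\<^sup>2) / (1 - cmod z)\<^sup>2) (at_left 1)"
      using fin(2)[OF that] by (intro tendsto_intros) auto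
    then show ?thesis using \<delta> by (intro order_tendstoD) auto
  qed
  then have "\<forall>\<^sub>F s in at_left 1. \<forall>z\<in>Z. (1 - s\<^sup>2) / (1 - cmod z)\<^sup>2 < \<delta>"
    using fin(1) by (intro eventually_ball_finite) auto
  then obtain b where b: "b < 1" "\<And>s z. b < s \<Longrightarrow> s < 1 \<Longrightarrow> z \<in> Z \<Longrightarrow> (1 - s\<^sup>2) / (1 - cmod z)\<^sup>2 < \<delta>"
    unfolding eventually_at_left_field by blast
  show ?thesis
  \<comment> \<open>The midpoint between \<open>max b 0\<close> and 1 is positive and exceeds
    \<open>b\<close>.\<close>
  proof (rule that[of "(max b 0 + 1) / 2"])
    fix w z assume w: "(max b 0 + 1) / 2 \<le> cmod w" "cmod w < 1" and z: "z \<in> Z"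
    have "b < cmod w" using w b(1) by (simp add: max_def split: if_splits)
    then have "1 - (pseudo_dist w z)\<^sup>2 < \<delta>"
      using b(2)[of "cmod w" z] one_minus_pseudo_dist_sq_le[OF w(2) fin(2)[OF z]] w z by linarith
    moreover have "(pseudo_dist w z)\<^sup>2 \<le> pseudo_dist w z"
      using pseudo_dist_nonneg[of w z] pseudo_dist_less_1[OF w(2) fin(2)[OF z]]
      by (simp add: power2_eq_square mult_left_le_one_le)
    ultimately show "1 - \<delta> \<le> pseudo_dist w z" by linarith
  qed (use b in auto)
qed

text \<open>A single radius \<open>r = 1 - \<delta>\<close> serves two purposes: it is the distance
  from the zeros at which SIP bounds \<open>\<Theta>\<close> from below, and the radius of discs
  about late zeros that stay that far from all other zeros.\<close>

lemma sharp_invertibility_pseudo_discs: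
  assumes inner: "inner_function \<Theta>" and SIP: "sharp_invertibility \<Theta>"
    and sep: "super_separated N a" and lim: "(\<lambda>k. if enat k < N then 1 - cmod (a k) else 0) \<longlonglongrightarrow> 0"
    and Z: "zero_set \<Theta> = a ` {k. enat k < N}" and \<epsilon>: "\<epsilon> > 0"
  obtains r K where "0 < r" "r < 1"
    "\<And>w. cmod w < 1 \<Longrightarrow> \<forall>k. enat k < N \<longrightarrow> r \<le> pseudo_dist w (a k) \<Longrightarrow> 1 / (1 + \<epsilon>) \<le> cmod (\<Theta> w)"
    "\<And>k j. k \<ge> K \<Longrightarrow> enat k < N \<Longrightarrow> enat j < N \<Longrightarrow> j \<noteq> k \<Longrightarrow> a j \<noteq> a k"
    "\<And>k j v. k \<ge> K \<Longrightarrow> enat k < N \<Longrightarrow> enat j < N \<Longrightarrow> j \<noteq> k \<Longrightarrow> cmod v \<le> r \<Longrightarrow>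
       r \<le> pseudo_dist (Moebius_function 0 (- a k) v) (a j)"
proof -
  have disc: "cmod (a k) < 1" if "enat k < N" for k
    using sep that by (simp add: super_separated_def)
  obtain \<delta> where \<delta>: "0 < \<delta>" "\<delta> < 1"
    and low: "\<And>w. cmod w < 1 \<Longrightarrow> (\<And>z. z \<in> zero_set \<Theta> \<Longrightarrow> 1 - \<delta> \<le> pseudo_dist w z) \<Longrightarrow> 1 / (1 + \<epsilon>) \<le> cmod (\<Theta> w)"
    using sharp_invertibility_lower_bound[OF inner SIP \<epsilon>] by blast
  have "\<delta> ^ 3 < 1" using \<delta> by (simp add: power_less_one_iff)
  \<comment> \<open>Moving from the zero to a point at distance at most \<open>1 - \<delta>\<close> costs a factor \<open>1 / \<delta>\<^sup>2\<close>, and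
    \<open>\<delta>\<^sup>3 / \<delta>\<^sup>2 = \<delta>\<close>.\<close>
  obtain K where K: "\<And>k j. k \<ge> K \<Longrightarrow> enat k < N \<Longrightarrow> enat j < N \<Longrightarrow> j \<noteq> k \<Longrightarrow>
      1 - (pseudo_dist (a k) (a j))\<^sup>2 \<le> \<delta> ^ 3"
    using super_separated_eventually[OF sep lim, of "\<delta> ^ 3"] \<delta>
    unfolding eventually_sequentially by (metis zero_less_power)
  have pd: "a j \<noteq> a k \<and> (\<forall>v. cmod v \<le> 1 - \<delta> \<longrightarrow> 1 - \<delta> \<le> pseudo_dist (Moebius_function 0 (- a k) v) (a j))"
    if kj: "k \<ge> K" "enat k < N" "enat j < N" "j \<noteq> k" for k j
  proof (intro conjI allI impI)
    show "a j \<noteq> a k" using K[OF kj] \<open>\<delta> ^ 3 < 1\<close> by (auto simp: pseudo_dist_def)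
    fix v assume v: "cmod v \<le> 1 - \<delta>"
    then have v1: "cmod v < 1" using \<delta> by simp
    define p where "p = pseudo_dist (Moebius_function 0 (- a k) v) (a j)"
    have "cmod (Moebius_function 0 (- a k) v) < 1" using v1 disc[OF kj(2)] by (simp add: Moebius_function_norm_lt_1)
    then have p: "0 \<le> p" "p < 1"
      using pseudo_dist_nonneg pseudo_dist_less_1 disc[OF kj(3)] by (auto simp: p_def)
    have "1 - p\<^sup>2 \<le> (1 - (pseudo_dist (a k) (a j))\<^sup>2) / (1 - cmod v)\<^sup>2"
      unfolding p_def by (rule one_minus_pseudo_dist_sq_Moebius_le[OF disc[OF kj(2)] disc[OF kj(3)] v1])
    also have "\<dots> \<le> \<delta> ^ 3 / \<delta>\<^sup>2"
      using K[OF kj] v \<delta> by (intro frac_le power_mono) auto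
    also have "\<dots> = \<delta>" using \<delta> by (simp add: power2_eq_square power3_eq_cube)
    finally have "1 - \<delta> \<le> p\<^sup>2" by simp
    also have "p\<^sup>2 \<le> p" using p by (simp add: power2_eq_square mult_left_le_one_le)
    finally show "1 - \<delta> \<le> p" .
  qed
  show ?thesis
  proof (rule that[of "1 - \<delta>" K])
    show "1 / (1 + \<epsilon>) \<le> cmod (\<Theta> w)"
      if "cmod w < 1" "\<forall>k. enat k < N \<longrightarrow> 1 - \<delta> \<le> pseudo_dist w (a k)" for w
      using low[OF that(1)] that(2) unfolding Z by blast
  qed (use \<delta> pd in auto)
qed

theorem proposition6p2:
  fixes \<Theta> :: "complex \<Rightarrow> complex" and N :: enat and a :: "nat \<Rightarrow> complex"
  assumes "inner_function \<Theta>"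
    and "lists_zeros \<Theta> N a"
    and "super_separated N a"
    and "sharp_invertibility \<Theta>"
  shows "thin_blaschke_product \<Theta>"
proof -
  have hol: "\<Theta> holomorphic_on unit_disc"
    using assms(1) by (intro Hinf_holomorphic_on inner_function_in_Hinf)
  have le1: "\<And>z. cmod z < 1 \<Longrightarrow> cmod (\<Theta> z) \<le> 1" by (rule inner_function_norm_le_1[OF assms(1)])
  obtain w0 where w0: "cmod w0 < 1" "\<Theta> w0 \<noteq> 0"
    using inner_function_not_identically_0[OF assms(1)] by blast
  have Z: "zero_set \<Theta> = a ` {k. enat k < N}" by (rule lists_zeros_zero_set[OF hol w0 assms(2)])
  have disc: "cmod (a k) < 1" "\<Theta> (a k) = 0" if "enat k < N" for k
    using assms(2) that by (auto simp: lists_zeros_def zero_set_def)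
  obtain \<Psi> where sum: "summable (\<lambda>k. if enat k < N then 1 - cmod (a k) else 0)"
    and \<Psi>: "\<Psi> holomorphic_on unit_disc" "\<And>z. cmod z < 1 \<Longrightarrow> cmod (\<Psi> z) \<le> 1"
      "\<And>z. cmod z < 1 \<Longrightarrow> \<Psi> z \<noteq> 0"
    and fac: "\<And>z. cmod z < 1 \<Longrightarrow> \<Theta> z = (\<Prod>k. if enat k < N then blaschke_factor (a k) z else 1) * \<Psi> z"
    and \<Theta>_le: "\<And>z. cmod z < 1 \<Longrightarrow> cmod (\<Theta> z) \<le> cmod (\<Psi> z)"
    by (rule blaschke_factorization[OF hol le1 w0 assms(2)], assumption) (rule that)
  note pd = sharp_invertibility_pseudo_discs[OF assms(1,4,3) summable_LIMSEQ_zero[OF sum] Z]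
  \<comment> \<open>On the boundary of the disc about \<open>a k\<close> the distance to
    \<open>a k\<close> is exactly \<open>r\<close>, so every zero is far enough for the lower
    bound.\<close>
  have on_circle: "1 / (1 + \<epsilon>) \<le> cmod (\<Theta> (Moebius_function 0 (- a k) v))"
    if low: "\<And>w. cmod w < 1 \<Longrightarrow> \<forall>k. enat k < N \<longrightarrow> r \<le> pseudo_dist w (a k) \<Longrightarrow> 1 / (1 + \<epsilon>) \<le> cmod (\<Theta> w)"
      and far: "\<And>j v. enat j < N \<Longrightarrow> j \<noteq> k \<Longrightarrow> cmod v \<le> r \<Longrightarrow> r \<le> pseudo_dist (Moebius_function 0 (- a k) v) (a j)"
      and k: "enat k < N" and r: "r < 1" and v: "cmod v = r" for \<epsilon> r k v
  proof (rule low)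
    have v1: "cmod v < 1" using v r by simp
    show "cmod (Moebius_function 0 (- a k) v) < 1" using v1 disc(1)[OF k] by (simp add: Moebius_function_norm_lt_1)
    show "\<forall>j. enat j < N \<longrightarrow> r \<le> pseudo_dist (Moebius_function 0 (- a k) v) (a j)"
      using far[of _ v] pseudo_dist_Moebius[OF disc(1)[OF k] v1] v by (metis order_refl)
  qed
  have thin: "\<forall>\<^sub>F k in sequentially. enat k < N \<longrightarrow>
      1 / (1 + \<epsilon>) \<le> (1 - (cmod (a k))\<^sup>2) * cmod (deriv \<Theta> (a k)) \<and>
      (1 - (cmod (a k))\<^sup>2) * cmod (deriv \<Theta> (a k)) \<le> 1" if \<epsilon>: "\<epsilon> > 0" for \<epsilon>
  proof -
    obtain r K where r: "0 < r" "r < 1"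
      and low: "\<And>w. cmod w < 1 \<Longrightarrow> \<forall>k. enat k < N \<longrightarrow> r \<le> pseudo_dist w (a k) \<Longrightarrow> 1 / (1 + \<epsilon>) \<le> cmod (\<Theta> w)"
      and ne: "\<And>k j. k \<ge> K \<Longrightarrow> enat k < N \<Longrightarrow> enat j < N \<Longrightarrow> j \<noteq> k \<Longrightarrow> a j \<noteq> a k"
      and far: "\<And>k j v. k \<ge> K \<Longrightarrow> enat k < N \<Longrightarrow> enat j < N \<Longrightarrow> j \<noteq> k \<Longrightarrow> cmod v \<le> r \<Longrightarrow>
        r \<le> pseudo_dist (Moebius_function 0 (- a k) v) (a j)"
      using pd[OF \<epsilon>] by blast
    have "1 / (1 + \<epsilon>) \<le> (1 - (cmod (a k))\<^sup>2) * cmod (deriv \<Theta> (a k)) \<and>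
        (1 - (cmod (a k))\<^sup>2) * cmod (deriv \<Theta> (a k)) \<le> 1" if k: "k \<ge> K" "enat k < N" for k
    proof -
      \<comment> \<open>A late zero is listed once, hence simple.\<close>
      have "{j. enat j < N \<and> a j = a k} = {k}" using ne[OF k] k by blast
      then have order_1: "zorder \<Theta> (a k) = 1"
        using assms(2) disc[OF k(2)] unfolding lists_zeros_def zero_set_def by force
      have nz: "\<Theta> (Moebius_function 0 (- a k) v) \<noteq> 0" if v: "cmod v \<le> r" "v \<noteq> 0" for v
      proof
        define q where "q = Moebius_function 0 (- a k) v"
        have v1: "cmod v < 1" using v r by simp
        assume "\<Theta> (Moebius_function 0 (- a k) v) = 0"
        then have "q \<in> zero_set \<Theta>"
          using v1 disc(1)[OF k(2)] by (simp add: q_def zero_set_def Moebius_function_norm_lt_1)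
        then obtain j where j: "enat j < N" "q = a j" unfolding Z by auto
        have "0 < pseudo_dist q (a j)"
        proof (cases "j = k")
          case True
          then show ?thesis using pseudo_dist_Moebius[OF disc(1)[OF k(2)] v1] v(2) by (simp add: q_def)
        next
          case False
          then show ?thesis using far[OF k j(1) False v(1)] r by (simp add: q_def)
        qed
        then show False using j(2) by (simp add: pseudo_dist_def)
      qed
      have circle: "1 / (1 + \<epsilon>) \<le> cmod (\<Theta> (Moebius_function 0 (- a k) v))" if "cmod v = r" for v
        by (rule on_circle[OF low far[OF k] k(2) r(2) that])
      show ?thesis
        using simple_zero_derivative_bounds[OF hol le1 disc(1)[OF k(2)] order_1 r nz circle disc(2)[OF k(2)]]
        by simp
    qed
    then show ?thesis unfolding eventually_sequentially by blast
  qed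
  have \<Psi>_ge: "1 / (1 + \<epsilon>) \<le> cmod (\<Psi> z)" if \<epsilon>: "\<epsilon> > 0" and z: "cmod z < 1" for \<epsilon> z
  proof -
    obtain r K where r: "0 < r" "r < 1"
      and low: "\<And>w. cmod w < 1 \<Longrightarrow> \<forall>k. enat k < N \<longrightarrow> r \<le> pseudo_dist w (a k) \<Longrightarrow> 1 / (1 + \<epsilon>) \<le> cmod (\<Theta> w)"
      and "\<And>k j. k \<ge> K \<Longrightarrow> enat k < N \<Longrightarrow> enat j < N \<Longrightarrow> j \<noteq> k \<Longrightarrow> a j \<noteq> a k"
      and far: "\<And>k j v. k \<ge> K \<Longrightarrow> enat k < N \<Longrightarrow> enat j < N \<Longrightarrow> j \<noteq> k \<Longrightarrow> cmod v \<le> r \<Longrightarrow>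
        r \<le> pseudo_dist (Moebius_function 0 (- a k) v) (a j)"
      using pd[OF \<epsilon>] by blast
    have "finite (a ` {k. k < K \<and> enat k < N})" "\<And>b. b \<in> a ` {k. k < K \<and> enat k < N} \<Longrightarrow> cmod b < 1"
      using disc(1) by auto
    from pseudo_dist_near_circle_finite[OF this, of "1 - r"] r
    obtain R where R: "0 < R" "R < 1"
      "\<And>w b. R \<le> cmod w \<Longrightarrow> cmod w < 1 \<Longrightarrow> b \<in> a ` {k. k < K \<and> enat k < N} \<Longrightarrow> 1 - (1 - r) \<le> pseudo_dist w b"
      by auto
    \<comment> \<open>For \<open>cmod w \<ge> R\<close> a zero within distance \<open>r\<close> of
      \<open>w\<close> must be late. Without such a zero the bound for \<open>\<Theta>\<close>
      passes to \<open>\<Psi>\<close> directly; otherwise the minimum principle carries it from the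
      boundary of the disc about that zero to \<open>w\<close>.\<close>
    have outer: "1 / (1 + \<epsilon>) \<le> cmod (\<Psi> w)" if w: "R \<le> cmod w" "cmod w < 1" for w
    proof (cases "\<exists>k. enat k < N \<and> pseudo_dist w (a k) < r")
      case False
      then show ?thesis using low[OF w(2)] \<Theta>_le[OF w(2)] by (meson linorder_not_less order_trans)
    next
      case True
      then obtain k where k: "enat k < N" "pseudo_dist w (a k) < r" by blast
      then have "\<not> k < K" using R(3)[OF w, of "a k"] by auto
      then have kK: "k \<ge> K" by simp
      define v where "v = Moebius_function 0 (a k) w"
      have v: "cmod v \<le> r" using k by (simp add: v_def pseudo_dist_eq_Moebius)
      define G where "G = (\<lambda>v. \<Psi> (Moebius_function 0 (- a k) v))"
      have M: "cmod (Moebius_function 0 (- a k) x) < 1" if "cmod x < 1" for x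
        using that disc(1)[OF k(1)] by (simp add: Moebius_function_norm_lt_1)
      have "1 / (1 + \<epsilon>) \<le> cmod (G v)"
      proof (rule minimum_modulus_cball[OF _ r _ _ v])
        show "G holomorphic_on unit_disc"
          unfolding G_def using disc(1)[OF k(1)] by (intro holomorphic_on_compose_Moebius \<Psi>) auto
        show "G x \<noteq> 0" if "cmod x \<le> r" for x using \<Psi>(3)[OF M[of x]] that r by (simp add: G_def)
        show "1 / (1 + \<epsilon>) \<le> cmod (G x)" if "cmod x = r" for x
        proof -
          have "1 / (1 + \<epsilon>) \<le> cmod (\<Theta> (Moebius_function 0 (- a k) x))"
            by (rule on_circle[OF low far[OF kK k(1)] k(1) r(2) that])
          also have "\<dots> \<le> cmod (G x)" unfolding G_def using that r by (intro \<Theta>_le M) auto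
          finally show ?thesis .
        qed
      qed
      then show ?thesis using Moebius_function_surj[OF disc(1)[OF k(1)] w(2)] by (simp add: G_def v_def)
    qed
    show ?thesis
    proof (cases "R \<le> cmod z")
      case True
      then show ?thesis using outer z by blast
    next
      case False
      \<comment> \<open>The zero-free \<open>\<Psi>\<close> inherits its lower bound on
        \<open>cmod z = R\<close> throughout the smaller disc.\<close>
      show ?thesis
        by (rule minimum_modulus_cball[OF \<Psi>(1) R(1,2)]) (use \<Psi>(3) outer R False in auto)
    qed
  qed
  have \<Psi>_1: "cmod (\<Psi> z) = 1" if z: "cmod z < 1" for z
  proof (rule antisym[OF \<Psi>(2)[OF z]])
    have "\<forall>\<^sub>F \<epsilon> in at_right 0. 1 / (1 + \<epsilon>) \<le> cmod (\<Psi> z)"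
      using \<Psi>_ge z by (auto simp: eventually_at_right_field intro!: exI[of _ 1])
    moreover have "((\<lambda>\<epsilon>::real. 1 / (1 + \<epsilon>)) \<longlongrightarrow> 1 / (1 + 0)) (at_right 0)" by (intro tendsto_intros) auto
    ultimately have "1 / (1 + 0) \<le> cmod (\<Psi> z)" by (intro tendsto_upperbound) auto
    then show "1 \<le> cmod (\<Psi> z)" by simp
  qed
  \<comment> \<open>The modulus is constantly 1, so it has an interior maximum at 0.\<close>
  have "\<Psi> constant_on unit_disc"
    using \<Psi>_1 by (intro maximum_modulus_principle[OF \<Psi>(1), of unit_disc 0]) auto
  then obtain c where c: "\<And>z. cmod z < 1 \<Longrightarrow> \<Psi> z = c" by (auto simp: constant_on_def)
  have "cmod c = 1" using \<Psi>_1[of 0] c[of 0] by simp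
  then have "blaschke_product_with_zeros \<Theta> N a"
    unfolding blaschke_product_with_zeros_def using disc(1) sum fac c by (auto simp: mult.commute intro!: exI[of _ c])
  moreover have "((\<lambda>k. (1 - (cmod (a k))\<^sup>2) * cmod (deriv \<Theta> (a k))) \<longlongrightarrow> 1)
      (inf sequentially (principal {k. enat k < N}))"
  proof (rule tendstoI)
    fix e :: real assume e: "0 < e"
    have "\<forall>\<^sub>F k in sequentially. enat k < N \<longrightarrow> dist ((1 - (cmod (a k))\<^sup>2) * cmod (deriv \<Theta> (a k))) 1 < e"
      using thin[OF e]
    proof eventually_elim
      case (elim k)
      have "1 - e < 1 / (1 + e)" using e by (simp add: field_simps)
      then show ?case using elim by (auto simp: dist_real_def)
    qed
    then show "\<forall>\<^sub>F k in inf sequentially (principal {k. enat k < N}).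
        dist ((1 - (cmod (a k))\<^sup>2) * cmod (deriv \<Theta> (a k))) 1 < e"
      by (simp add: eventually_inf_principal)
  qed
  ultimately show ?thesis unfolding thin_blaschke_product_def by blast
qed

end
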